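(* There exists a randomized algorithm which, given cut-query oracle access to an unweighted, undirected simple graph $G=(V,E)$ on $n$ vertices, makes $\widetilde{O}(n)$ queries and with high probability outputs an exact global minimum cut of $G$.
   Context: A cut query takes a set $S\subseteq V$ and returns $c(S)$, the number of edges of $G$ with exactly one endpoint in $S$. A global minimum cut is a set $S$ with $\emptyset\neq S\subsetneq V$ minimizing $c(S)$. $\widetilde{O}(x)$ denotes $O(x\cdot \mathrm{polylog}(x))$. "With high probability" means with probability at least $1-n^{-\Omega(1)}$. *)

theory Defs
  imports "HOL-Probability.Probability_Mass_Function"
begin

definition simple_graph :: "nat \<Rightarrow> nat set set \<Rightarrow> bool" where
  "simple_graph n E \<longleftrightarrow> E \<subseteq> {e. \<exists>u v. u \<noteq> v \<and> u < n \<and> v < n \<and> e = {u, v}}"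

definition cut_val :: "nat set set \<Rightarrow> nat set \<Rightarrow> nat" where
  "cut_val E S = card {e \<in> E. card (e \<inter> S) = 1}"

definition is_global_min_cut :: "nat \<Rightarrow> nat set set \<Rightarrow> nat set \<Rightarrow> bool" where
  "is_global_min_cut n E S \<longleftrightarrow>
     S \<noteq> {} \<and> S \<subset> {..<n} \<and>
     (\<forall>T. T \<noteq> {} \<and> T \<subset> {..<n} \<longrightarrow> cut_val E S \<le> cut_val E T)"

(* Deterministic adaptive cut-query algorithm (decision tree): either output a set,
   or query a set S and continue depending on the answer c(S). *)
datatype qtree = Output "nat set" | Query "nat set" "nat \<Rightarrow> qtree"

primrec run :: "(nat set \<Rightarrow> nat) \<Rightarrow> qtree \<Rightarrow> nat set" where
  "run c (Output S) = S"
| "run c (Query S f) = run c (f (c S))"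

primrec num_queries :: "(nat set \<Rightarrow> nat) \<Rightarrow> qtree \<Rightarrow> nat" where
  "num_queries c (Output S) = 0"
| "num_queries c (Query S f) = Suc (num_queries c (f (c S)))"

end

theory Submission
  imports Defs "HOL-Probability.Product_PMF"
begin

text \<open>
  The minimum degree \<open>d\<close> bounds the minimum cut, and singleton cuts are read off the degrees. A minimum
  cut \<open>S\<close> of value less than \<open>d\<close> is found by star contraction: choose each vertex as a centre with
  probability of order \<open>log n / d\<close>, and merge every other vertex into a uniformly random neighbouring
  centre. By minimality at most half of the neighbours of any vertex lie across \<open>S\<close>, and the number of
  crossing arcs is less than \<open>2 d\<close>; hence with constant probability all merges respect \<open>S\<close>, while only
  \<open>O(n log n / d)\<close> vertices survive. In the contracted graph, \<open>d\<close> successive maximal spanning forests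
  contain all edges of every cut of value less than \<open>d\<close>; each forest edge costs \<open>O(log n)\<close> queries by
  bisection, \<open>O(n log\<^sup>2 n)\<close> in total. Repeating \<open>O(log n)\<close> times makes the failure probability \<open>1/n\<close>.
\<close>

text \<open>Let \<open>x v\<close> be the fraction of sampled neighbours of \<open>v\<close> lying
  across \<open>S\<close>. Given the centres, all merges respect \<open>S\<close> with probability
  at least the product of the \<open>1 - x v\<close>. The sum of the \<open>x v\<close> is bounded
  on average because \<open>v\<close> has at least \<open>d\<close> neighbours while all crossing
  arcs together number less than \<open>2 d\<close>. But a bounded sum keeps the product away from 0
  only if every single \<open>x v\<close> stays away from 1. This is what the bound of one half on
  crossing neighbours is for, and the logarithmic factor in the sampling rate makes it survive at
  all vertices at once.

  Randomness has to be drawn before the graph, and hence \<open>d\<close>, is known. A seed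
  therefore consists of integer ranks, to be thresholded later, and of integers to be reduced modulo
  the number of neighbouring centres found. For each seed the algorithm is a deterministic decision
  tree valid for all graphs, so query bounds involve no probability and probability bounds no
  queries.\<close>

section \<open>Query complexity\<close>

text \<open>
  Continuation-passing form of ``\<open>q\<close> queries suffice, on every graph of the class \<open>G\<close>, to produce
  a value related to the graph by \<open>P\<close>''. Knowledge gained from answers is recorded by shrinking \<open>G\<close>.
\<close>

definition solves :: "nat set set set \<Rightarrow> nat \<Rightarrow> (nat set set \<Rightarrow> 'a \<Rightarrow> bool) \<Rightarrow> bool" where
  "solves G q P \<longleftrightarrow> (\<forall>k. \<exists>t. \<forall>E\<in>G. \<exists>x. P E x \<and> run (cut_val E) t = run (cut_val E) (k x) \<and>
     num_queries (cut_val E) t \<le> q + num_queries (cut_val E) (k x))"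

lemma solves_return:
  assumes "\<And>E. E \<in> G \<Longrightarrow> P E x"
  shows "solves G q P"
  unfolding solves_def
proof
  fix k
  show "\<exists>t. \<forall>E\<in>G. \<exists>x. P E x \<and> run (cut_val E) t = run (cut_val E) (k x) \<and>
     num_queries (cut_val E) t \<le> q + num_queries (cut_val E) (k x)"
    by (rule exI[of _ "k x"], rule ballI, rule exI[of _ x]) (simp add: assms)
qed

lemma solves_mono:
  assumes "solves G q P" "G' \<subseteq> G" "q \<le> q'" "\<And>E x. E \<in> G' \<Longrightarrow> P E x \<Longrightarrow> P' E x"
  shows "solves G' q' P'"
  unfolding solves_def
proof
  fix k
  obtain t where t: "\<And>E. E\<in>G \<Longrightarrow> \<exists>x. P E x \<and> run (cut_val E) t = run (cut_val E) (k x) \<and>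
     num_queries (cut_val E) t \<le> q + num_queries (cut_val E) (k x)"
    using assms(1) unfolding solves_def by meson
  show "\<exists>t. \<forall>E\<in>G'. \<exists>x. P' E x \<and> run (cut_val E) t = run (cut_val E) (k x) \<and>
     num_queries (cut_val E) t \<le> q' + num_queries (cut_val E) (k x)"
  proof (rule exI[of _ t], rule ballI)
    fix E assume E: "E \<in> G'"
    then obtain x where "P E x" "run (cut_val E) t = run (cut_val E) (k x)"
      "num_queries (cut_val E) t \<le> q + num_queries (cut_val E) (k x)"
      using t assms(2) by blast
    then show "\<exists>x. P' E x \<and> run (cut_val E) t = run (cut_val E) (k x) \<and>
     num_queries (cut_val E) t \<le> q' + num_queries (cut_val E) (k x)"
      using assms(3,4) E by (intro exI[of _ x]) auto
  qed
qed

lemma solves_query: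
  assumes "\<And>y. solves {E \<in> G. cut_val E S = y} q P"
  shows "solves G (Suc q) P"
  unfolding solves_def
proof
  fix k
  have "\<forall>y. \<exists>t. \<forall>E\<in>{E \<in> G. cut_val E S = y}. \<exists>x. P E x \<and> run (cut_val E) t = run (cut_val E) (k x) \<and>
     num_queries (cut_val E) t \<le> q + num_queries (cut_val E) (k x)"
    using assms unfolding solves_def by blast
  from choice[OF this] obtain f where f: "\<forall>y. \<forall>E\<in>{E \<in> G. cut_val E S = y}.
     \<exists>x. P E x \<and> run (cut_val E) (f y) = run (cut_val E) (k x) \<and>
     num_queries (cut_val E) (f y) \<le> q + num_queries (cut_val E) (k x)"
    ..
  show "\<exists>t. \<forall>E\<in>G. \<exists>x. P E x \<and> run (cut_val E) t = run (cut_val E) (k x) \<and>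
     num_queries (cut_val E) t \<le> Suc q + num_queries (cut_val E) (k x)"
    by (rule exI[of _ "Query S f"]) (use f in auto)
qed

text \<open>Quantifying over the continuation makes sequencing an instantiation: the first
  computation receives the trees of the second as its continuation, and no substitution at leaves is
  carried out. The second may depend on \<open>x\<close> and answers only for graphs consistent with
  it.\<close>

lemma solves_bind:
  assumes "solves G q P" "\<And>x. solves {E \<in> G. P E x} q' Q"
  shows "solves G (q + q') Q"
  unfolding solves_def
proof
  fix k
  have "\<forall>x. \<exists>t. \<forall>E\<in>{E \<in> G. P E x}. \<exists>y. Q E y \<and> run (cut_val E) t = run (cut_val E) (k y) \<and>
     num_queries (cut_val E) t \<le> q' + num_queries (cut_val E) (k y)"
    using assms(2) unfolding solves_def by blast
  from choice[OF this] obtain f where f: "\<forall>x. \<forall>E\<in>{E \<in> G. P E x}.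
     \<exists>y. Q E y \<and> run (cut_val E) (f x) = run (cut_val E) (k y) \<and>
     num_queries (cut_val E) (f x) \<le> q' + num_queries (cut_val E) (k y)"
    ..
  obtain t where t: "\<And>E. E\<in>G \<Longrightarrow> \<exists>x. P E x \<and> run (cut_val E) t = run (cut_val E) (f x) \<and>
     num_queries (cut_val E) t \<le> q + num_queries (cut_val E) (f x)"
    using assms(1) unfolding solves_def by meson
  show "\<exists>t. \<forall>E\<in>G. \<exists>y. Q E y \<and> run (cut_val E) t = run (cut_val E) (k y) \<and>
     num_queries (cut_val E) t \<le> q + q' + num_queries (cut_val E) (k y)"
  proof (rule exI[of _ t], rule ballI)
    fix E assume E: "E \<in> G"
    obtain x where x: "P E x" "run (cut_val E) t = run (cut_val E) (f x)"
      "num_queries (cut_val E) t \<le> q + num_queries (cut_val E) (f x)" using t[OF E] by blast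
    obtain y where y: "Q E y" "run (cut_val E) (f x) = run (cut_val E) (k y)"
      "num_queries (cut_val E) (f x) \<le> q' + num_queries (cut_val E) (k y)" using f E x(1) by blast
    show "\<exists>y. Q E y \<and> run (cut_val E) t = run (cut_val E) (k y) \<and>
     num_queries (cut_val E) t \<le> q + q' + num_queries (cut_val E) (k y)"
      using x y by (intro exI[of _ y]) auto
  qed
qed

lemma solves_bind':
  assumes "solves G q P" "\<And>x. solves {E \<in> G. P E x} q' Q" "q + q' \<le> q''"
  shows "solves G q'' Q"
  using solves_mono[OF solves_bind[OF assms(1,2)] subset_refl assms(3)] by blast

lemma solves_cut_val: "solves G 1 (\<lambda>E y. y = cut_val E S)"
  unfolding One_nat_def
  by (rule solves_query[where S = S]) (rule solves_return, auto)

lemma solves_map: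
  assumes "\<And>x. x \<in> set xs \<Longrightarrow> solves G q (P x)"
  shows "solves G (q * length xs) (\<lambda>E f. \<forall>x\<in>set xs. P x E (f x))"
  using assms
proof (induction xs)
  case Nil
  show ?case by (rule solves_return[where x = undefined]) auto
next
  case (Cons x xs)
  have IH: "solves G (q * length xs) (\<lambda>E f. \<forall>x\<in>set xs. P x E (f x))"
    using Cons by auto
  show ?case
  proof (rule solves_bind'[OF IH])
    fix f
    show "solves {E \<in> G. \<forall>x\<in>set xs. P x E (f x)} q (\<lambda>E f. \<forall>x\<in>set (x # xs). P x E (f x))"
    proof (rule solves_bind'[where q = q and q' = 0 and P = "P x"])
      show "solves {E \<in> G. \<forall>x\<in>set xs. P x E (f x)} q (P x)"
        by (rule solves_mono[of G q "P x"]) (use Cons.prems in auto)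
    next
      fix y
      show "solves {E \<in> {E \<in> G. \<forall>x\<in>set xs. P x E (f x)}. P x E y} 0
         (\<lambda>E f. \<forall>x\<in>set (x # xs). P x E (f x))"
        by (rule solves_return[where x = "f(x := y)"]) auto
    qed auto
  qed auto
qed

section \<open>Finding edges\<close>

definition graphs :: "nat \<Rightarrow> nat set set set" where
  "graphs n = {E. simple_graph n E}"

text \<open>Ordered pairs are counted, so an edge inside \<open>A \<inter> B\<close> counts twice.\<close>

definition arcs :: "nat set set \<Rightarrow> nat set \<Rightarrow> nat set \<Rightarrow> nat" where
  "arcs E A B = card {(a, b). a \<in> A \<and> b \<in> B \<and> {a, b} \<in> E}"

definition nbrs :: "nat set set \<Rightarrow> nat \<Rightarrow> nat set" where
  "nbrs E v = {w. {v, w} \<in> E}"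

lemma graphsD:
  assumes "E \<in> graphs n" "{a, b} \<in> E"
  shows "a < n" "b < n" "a \<noteq> b"
proof -
  obtain u v where "u \<noteq> v" "u < n" "v < n" "{a, b} = {u, v}"
    using assms by (auto simp: graphs_def simple_graph_def)
  then show "a < n" "b < n" "a \<noteq> b" by (auto simp: doubleton_eq_iff)
qed

lemma graphs_edgeE:
  assumes "E \<in> graphs n" "e \<in> E"
  obtains a b where "a < n" "b < n" "a \<noteq> b" "e = {a, b}"
  using assms by (auto simp: graphs_def simple_graph_def)

lemma graphs_subset: "E \<in> graphs n \<Longrightarrow> F \<subseteq> E \<Longrightarrow> F \<in> graphs n"
  by (auto simp: graphs_def simple_graph_def)

lemma finite_arcs: "E \<in> graphs n \<Longrightarrow> finite {(a, b). a \<in> A \<and> b \<in> B \<and> {a, b} \<in> E}"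
  by (rule finite_subset[of _ "{..<n} \<times> {..<n}"]) (auto dest: graphsD)

lemma arcs_commute: "arcs E A B = arcs E B A"
  unfolding arcs_def
  by (rule bij_betw_same_card[of "\<lambda>(a, b). (b, a)"], rule bij_betwI[where g = "\<lambda>(a, b). (b, a)"])
     (auto simp: insert_commute)

lemma arcs_Un_left:
  assumes "E \<in> graphs n" "A \<inter> A' = {}"
  shows "arcs E (A \<union> A') B = arcs E A B + arcs E A' B"
proof -
  have "{(a, b). a \<in> A \<union> A' \<and> b \<in> B \<and> {a, b} \<in> E} =
    {(a, b). a \<in> A \<and> b \<in> B \<and> {a, b} \<in> E} \<union> {(a, b). a \<in> A' \<and> b \<in> B \<and> {a, b} \<in> E}" by auto
  then show ?thesis unfolding arcs_def
    using assms by (simp, intro card_Un_disjoint finite_arcs[OF assms(1)]) auto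
qed

lemma arcs_Un_right:
  assumes "E \<in> graphs n" "B \<inter> B' = {}"
  shows "arcs E A (B \<union> B') = arcs E A B + arcs E A B'"
  using arcs_Un_left[OF assms] by (simp add: arcs_commute)

lemma arcs_diff:
  assumes "E \<in> graphs n" "H \<subseteq> E"
  shows "arcs E A B = arcs H A B + arcs (E - H) A B"
proof -
  have "{(a, b). a \<in> A \<and> b \<in> B \<and> {a, b} \<in> E} =
    {(a, b). a \<in> A \<and> b \<in> B \<and> {a, b} \<in> H} \<union> {(a, b). a \<in> A \<and> b \<in> B \<and> {a, b} \<in> E - H}"
    using assms by auto
  then show ?thesis unfolding arcs_def
    using assms graphs_subset[OF assms(1)]
    by (simp only:, intro card_Un_disjoint finite_arcs[where n = n]) auto
qed

lemma arcs_pos_iff: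
  assumes "E \<in> graphs n"
  shows "arcs E A B > 0 \<longleftrightarrow> (\<exists>a\<in>A. \<exists>b\<in>B. {a, b} \<in> E)"
  unfolding arcs_def card_gt_0_iff using finite_arcs[OF assms] by auto

lemma cut_val_arcs:
  assumes E: "E \<in> graphs n"
  shows "cut_val E S = arcs E S ({..<n} - S)"
proof -
  have "bij_betw (\<lambda>(a, b). {a, b}) {(a, b). a \<in> S \<and> b \<in> {..<n} - S \<and> {a, b} \<in> E}
      {e \<in> E. card (e \<inter> S) = 1}"
    unfolding bij_betw_def
  proof
    show "inj_on (\<lambda>(a, b). {a, b}) {(a, b). a \<in> S \<and> b \<in> {..<n} - S \<and> {a, b} \<in> E}"
      by (auto simp: inj_on_def doubleton_eq_iff)
    show "(\<lambda>(a, b). {a, b}) ` {(a, b). a \<in> S \<and> b \<in> {..<n} - S \<and> {a, b} \<in> E}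
      = {e \<in> E. card (e \<inter> S) = 1}" (is "?L = ?R")
    proof
      show "?L \<subseteq> ?R" by auto
      show "?R \<subseteq> ?L"
      proof
        fix e assume e: "e \<in> ?R"
        then obtain a b where ab: "a < n" "b < n" "a \<noteq> b" "e = {a, b}"
          using graphs_edgeE[OF E] by (metis (no_types, lifting) mem_Collect_eq)
        have "(a \<in> S \<and> b \<notin> S) \<or> (a \<notin> S \<and> b \<in> S)"
          using e ab by (cases "a \<in> S"; cases "b \<in> S") auto
        then show "e \<in> ?L"
        proof
          assume "a \<in> S \<and> b \<notin> S"
          then have "(a, b) \<in> {(a, b). a \<in> S \<and> b \<in> {..<n} - S \<and> {a, b} \<in> E}" using ab e by auto
          then show ?thesis using ab(4) by force
        next
          assume "a \<notin> S \<and> b \<in> S"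
          then have "(b, a) \<in> {(a, b). a \<in> S \<and> b \<in> {..<n} - S \<and> {a, b} \<in> E}"
            using ab e by (auto simp: insert_commute)
          then show ?thesis using ab(4) by (force simp: insert_commute)
        qed
      qed
    qed
  qed
  from bij_betw_same_card[OF this] show ?thesis unfolding cut_val_def arcs_def by simp
qed

text \<open>An edge between \<open>A\<close> and \<open>B\<close> is counted by c(\<open>A\<close>)
  and by c(\<open>B\<close>) but not by c(\<open>A \<union> B\<close>), while edges to the remaining
  vertices cancel. Hence c(\<open>A\<close>) + c(\<open>B\<close>) - c(\<open>A \<union> B\<close>)
  is twice the wanted number.\<close>

lemma solves_arcs:
  assumes G: "G \<subseteq> graphs n" and dis: "A \<inter> B = {}" "A \<subseteq> {..<n}" "B \<subseteq> {..<n}"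
  shows "solves G 3 (\<lambda>E y. y = arcs E A B)"
proof -
  have eq: "arcs E A B = (cut_val E A + cut_val E B - cut_val E (A \<union> B)) div 2"
    if "E \<in> G" for E
  proof -
    have E: "E \<in> graphs n" using that G by auto
    define X where "X = {..<n} - (A \<union> B)"
    have "{..<n} - A = B \<union> X" "{..<n} - B = A \<union> X" "B \<inter> X = {}" "A \<inter> X = {}"
      using dis by (auto simp: X_def)
    then have "cut_val E A = arcs E A B + arcs E A X" "cut_val E B = arcs E A B + arcs E B X"
      "cut_val E (A \<union> B) = arcs E A X + arcs E B X"
      using E dis by (auto simp: cut_val_arcs arcs_Un_right arcs_Un_left arcs_commute[of E B A] X_def[symmetric])
    then show ?thesis by simp
  qed
  show ?thesis
    apply (rule solves_bind'[OF solves_cut_val[of _ A], where q' = 2])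
     apply (rule solves_bind'[OF solves_cut_val[of _ B], where q' = 1])
      apply (rule solves_bind'[OF solves_cut_val[of _ "A \<union> B"], where q' = 0])
       apply (rule solves_return)
       apply (auto simp: eq)
    done
qed

text \<open>Bisection of \<open>A\<close>: at least one of two halves still has an edge of
  \<open>E - H\<close> to \<open>B\<close>. The set \<open>H\<close> of edges already found is
  known, so its share is subtracted from an answer without asking.\<close>

lemma find_endpoint:
  assumes "G \<subseteq> graphs n" "A \<subseteq> {..<n}" "B \<subseteq> {..<n}" "A \<inter> B = {}" "card A \<le> 2 ^ i"
    and "\<And>E. E \<in> G \<Longrightarrow> H \<subseteq> E \<and> arcs (E - H) A B > 0"
  shows "solves G (3 * i) (\<lambda>E a. a \<in> A \<and> arcs (E - H) {a} B > 0)"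
  using assms
proof (induction i arbitrary: A G)
  case 0
  have "finite A" using 0 finite_subset by blast
  have "card A \<le> 1" using 0(5) by simp
  then have "card A = 0 \<or> card A = 1" by linarith
  then consider "A = {}" | a where "A = {a}" using \<open>finite A\<close> by (metis card_0_eq card_1_singletonE)
  then show ?case
  proof cases
    case 1
    then have "G = {}" using 0(6) by (auto simp: arcs_def)
    then show ?thesis by (auto intro: solves_return)
  next
    case 2
    then show ?thesis using 0(6) by (intro solves_return[where x = a]) auto
  qed
next
  case (Suc i)
  obtain A1 where A1: "A1 \<subseteq> A" "card A1 = card A div 2"
    by (metis div_le_dividend obtain_subset_with_card_n)
  have fin: "finite A" using Suc.prems(2) finite_subset by blast
  have c2: "card (A - A1) = card A - card A div 2"
    using A1 fin by (simp add: card_Diff_subset finite_subset)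
  show ?case
  proof (rule solves_bind'[OF solves_arcs[OF Suc.prems(1), of A1 B], where q' = "3 * i"])
    fix y
    let ?G = "{E \<in> G. y = arcs E A1 B}"
    have split: "arcs (E - H) A B = arcs (E - H) A1 B + arcs (E - H) (A - A1) B"
      "arcs E A1 B = arcs H A1 B + arcs (E - H) A1 B" if "E \<in> G" for E
    proof -
      have E: "E \<in> graphs n" "H \<subseteq> E" using that Suc.prems by auto
      show "arcs (E - H) A B = arcs (E - H) A1 B + arcs (E - H) (A - A1) B"
        using arcs_Un_left[OF graphs_subset[OF E(1), of "E - H"], of A1 "A - A1" B] A1(1)
        by (auto simp: Un_absorb1)
      show "arcs E A1 B = arcs H A1 B + arcs (E - H) A1 B" by (rule arcs_diff[OF E])
    qed
    show "solves ?G (3 * i) (\<lambda>E a. a \<in> A \<and> arcs (E - H) {a} B > 0)"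
    proof (cases "y > arcs H A1 B")
      case True
      have "solves ?G (3 * i) (\<lambda>E a. a \<in> A1 \<and> arcs (E - H) {a} B > 0)"
        by (rule Suc.IH) (use Suc.prems A1 True split in auto)
      then show ?thesis by (rule solves_mono) (use A1 in auto)
    next
      case False
      have "solves ?G (3 * i) (\<lambda>E a. a \<in> A - A1 \<and> arcs (E - H) {a} B > 0)"
      proof (rule Suc.IH)
        fix E assume E: "E \<in> ?G"
        have "arcs (E - H) A B > 0" "H \<subseteq> E" using E Suc.prems by auto
        then show "H \<subseteq> E \<and> arcs (E - H) (A - A1) B > 0"
          using split[of E] E False by auto
      qed (use Suc.prems c2 in auto)
      then show ?thesis by (rule solves_mono) auto
    qed
  qed (use A1 Suc.prems in auto)
qed

text \<open>One bisection fixes the end \<open>a\<close> in \<open>A\<close>, a second one searches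
  \<open>B\<close> against \<open>{a}\<close>; each takes \<open>L\<close> halvings of three
  queries.\<close>

lemma find_edge:
  assumes G: "G \<subseteq> graphs n" and AB: "A \<subseteq> {..<n}" "B \<subseteq> {..<n}" "A \<inter> B = {}" and L: "n \<le> 2 ^ L"
    and H: "\<And>E. E \<in> G \<Longrightarrow> H \<subseteq> E \<and> arcs (E - H) A B > 0"
  shows "solves G (6 * L) (\<lambda>E (a, b). a \<in> A \<and> b \<in> B \<and> {a, b} \<in> E - H)"
proof -
  have card: "card X \<le> 2 ^ L" if "X \<subseteq> {..<n}" for X
    using card_mono[OF _ that] L by auto
  show ?thesis
  proof (rule solves_bind'[OF find_endpoint[OF G AB card[OF AB(1)]], where q' = "3 * L"])
    show "H \<subseteq> E \<and> 0 < arcs (E - H) A B" if "E \<in> G" for E using H[OF that] .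
    fix a
    let ?G = "{E \<in> G. a \<in> A \<and> 0 < arcs (E - H) {a} B}"
    show "solves ?G (3 * L) (\<lambda>E (a, b). a \<in> A \<and> b \<in> B \<and> {a, b} \<in> E - H)"
    proof (cases "a \<in> A")
      case False
      then show ?thesis by (auto intro: solves_return)
    next
      case True
      show ?thesis
      proof (rule solves_bind'[OF find_endpoint[of _ n B "{a}" L H], where q' = 0])
        fix b
        show "solves {E \<in> ?G. b \<in> B \<and> 0 < arcs (E - H) {b} {a}} 0
          (\<lambda>E (a, b). a \<in> A \<and> b \<in> B \<and> {a, b} \<in> E - H)"
        proof (rule solves_return[where x = "(a, b)"])
          fix E assume E: "E \<in> {E \<in> ?G. b \<in> B \<and> 0 < arcs (E - H) {b} {a}}"
          have "E - H \<in> graphs n" using E G graphs_subset by blast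
          from arcs_pos_iff[OF this] E
          show "case (a, b) of (a, b) \<Rightarrow> a \<in> A \<and> b \<in> B \<and> {a, b} \<in> E - H"
            by (auto simp: insert_commute)
        qed
      next
        show "?G \<subseteq> graphs n" using G by auto
        show "card B \<le> 2 ^ L" by (rule card[OF AB(2)])
      qed (use True AB H in \<open>auto simp: arcs_commute\<close>)
    qed
  qed auto
qed

section \<open>Sparse certificates of contracted graphs\<close>

definition crosses :: "nat set set \<Rightarrow> nat set \<Rightarrow> bool" where
  "crosses F T \<longleftrightarrow> (\<exists>a b. {a, b} \<in> F \<and> a \<in> T \<and> b \<notin> T)"

lemma crosses_iff:
  assumes "F \<in> graphs n"
  shows "crosses F T \<longleftrightarrow> cut_val F T > 0"
  unfolding cut_val_arcs[OF assms] arcs_pos_iff[OF assms] crosses_def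
  using graphsD[OF assms] by blast

lemma cut_val_diff:
  assumes "E \<in> graphs n" "H \<subseteq> E"
  shows "cut_val E T = cut_val H T + cut_val (E - H) T"
  using arcs_diff[OF assms] cut_val_arcs assms graphs_subset by (metis Diff_subset)

text \<open>
  A labelling \<open>l\<close> stands for the contraction of its fibres; \<open>sat n l T\<close> says that \<open>T\<close> is a union of
  fibres, that is, a cut of the contracted graph.
\<close>

definition sat :: "nat \<Rightarrow> (nat \<Rightarrow> nat) \<Rightarrow> nat set \<Rightarrow> bool" where
  "sat n l T \<longleftrightarrow> (\<forall>u<n. \<forall>v<n. l u = l v \<longrightarrow> (u \<in> T \<longleftrightarrow> v \<in> T))"

lemma sat_merge:
  assumes "sat n l T" "a < n" "b < n" "a \<in> T \<longleftrightarrow> b \<in> T"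
  shows "sat n (\<lambda>v. if l v = l a then l b else l v) T"
  using assms unfolding sat_def by metis

text \<open>
  Each colour \<open>x\<close> is treated once: if an edge of \<open>E - H\<close> leaves its fibre, \<open>x\<close> is recoloured away along
  this edge, otherwise the fibre is closed. A closed fibre never receives vertices later, because no
  edge of \<open>E - H\<close> reaches it.
\<close>

lemma forest_loop:
  assumes "G \<subseteq> graphs n" "n \<le> 2 ^ L" "\<And>E. E \<in> G \<Longrightarrow> H \<subseteq> E"
    "\<And>E x. E \<in> G \<Longrightarrow> x \<in> D \<Longrightarrow> \<not> crosses (E - H) {v. v < n \<and> l v = x}"
  shows "solves G ((3 + 6 * L) * length xs)
    (\<lambda>E (l', F). F \<subseteq> E - H \<and> l' ` {..<n} \<subseteq> l ` {..<n} \<and>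
       (\<forall>T. sat n l T \<and> \<not> crosses F T \<longrightarrow> sat n l' T) \<and>
       (\<forall>x\<in>D \<union> set xs. \<not> crosses (E - H) {v. v < n \<and> l' v = x}))"
  using assms
proof (induction xs arbitrary: G D l)
  case Nil
  show ?case by (rule solves_return[where x = "(l, {})"]) (use Nil in auto)
next
  case (Cons x xs)
  define A where "A = {v. v < n \<and> l v = x}"
  define B where "B = {..<n} - A"
  have AB: "A \<subseteq> {..<n}" "B \<subseteq> {..<n}" "A \<inter> B = {}" by (auto simp: A_def B_def)
  define P where "P = (\<lambda>E (l', F). F \<subseteq> E - H \<and> l' ` {..<n} \<subseteq> l ` {..<n} \<and>
       (\<forall>T. sat n l T \<and> \<not> crosses F T \<longrightarrow> sat n l' T) \<and>
       (\<forall>x\<in>D \<union> set (x # xs). \<not> crosses (E - H) {v. v < n \<and> l' v = x}))"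
  have "solves G ((3 + 6 * L) * length (x # xs)) P"
  proof (rule solves_bind'[OF solves_arcs[OF Cons.prems(1) AB(3,1,2)],
        where q' = "6 * L + (3 + 6 * L) * length xs"])
    fix y
    let ?G = "{E \<in> G. y = arcs E A B}"
    have y: "y = arcs H A B + arcs (E - H) A B" "E \<in> graphs n" "E - H \<in> graphs n"
      "crosses (E - H) A \<longleftrightarrow> arcs (E - H) A B > 0" if "E \<in> ?G" for E
    proof -
      show E: "E \<in> graphs n" using that Cons.prems by auto
      show "y = arcs H A B + arcs (E - H) A B" using arcs_diff[OF E] that Cons.prems by auto
      show "E - H \<in> graphs n" using graphs_subset E by blast
      then show "crosses (E - H) A \<longleftrightarrow> arcs (E - H) A B > 0"
        by (simp add: crosses_iff cut_val_arcs B_def)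
    qed
    show "solves ?G (6 * L + (3 + 6 * L) * length xs) P"
    proof (cases "y > arcs H A B")
      case False
      have "solves ?G ((3 + 6 * L) * length xs)
        (\<lambda>E (l', F). F \<subseteq> E - H \<and> l' ` {..<n} \<subseteq> l ` {..<n} \<and>
       (\<forall>T. sat n l T \<and> \<not> crosses F T \<longrightarrow> sat n l' T) \<and>
       (\<forall>x\<in>insert x D \<union> set xs. \<not> crosses (E - H) {v. v < n \<and> l' v = x}))"
      proof (rule Cons.IH)
        fix E z assume E: "E \<in> ?G" and z: "z \<in> insert x D"
        have "\<not> crosses (E - H) A" using y[OF E] False by auto
        then show "\<not> crosses (E - H) {v. v < n \<and> l v = z}"
          using z E Cons.prems(4) by (auto simp: A_def)
      qed (use Cons.prems in auto)
      then show ?thesis by (rule solves_mono) (auto simp: P_def)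
    next
      case True
      have edge: "solves ?G (6 * L) (\<lambda>E (a, b). a \<in> A \<and> b \<in> B \<and> {a, b} \<in> E - H)"
      proof (rule find_edge[OF _ AB Cons.prems(2)])
        fix E assume E: "E \<in> ?G"
        show "H \<subseteq> E \<and> 0 < arcs (E - H) A B" using y[OF E] True Cons.prems(3) E by auto
      qed (use Cons.prems in auto)
      show ?thesis
      proof (rule solves_bind[OF edge])
        fix p :: "nat \<times> nat"
        obtain a b where p: "p = (a, b)" by fastforce
        let ?G' = "{E \<in> ?G. case p of (a, b) \<Rightarrow> a \<in> A \<and> b \<in> B \<and> {a, b} \<in> E - H}"
        define l2 where "l2 = (\<lambda>v. if l v = l a then l b else l v)"
        define Q where "Q = (\<lambda>E (l', F). F \<subseteq> E - H \<and> l' ` {..<n} \<subseteq> l2 ` {..<n} \<and>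
          (\<forall>T. sat n l2 T \<and> \<not> crosses F T \<longrightarrow> sat n l' T) \<and>
          (\<forall>x\<in>insert x D \<union> set xs. \<not> crosses (E - H) {v. v < n \<and> l' v = x}))"
        have rec: "solves ?G' ((3 + 6 * L) * length xs) Q" unfolding Q_def
        proof (rule Cons.IH)
          fix E z assume E: "E \<in> ?G'" and z: "z \<in> insert x D"
          have ab: "a < n" "b < n" "l a = x" "l b \<noteq> x" "{a, b} \<in> E - H"
            using E by (auto simp: p A_def B_def)
          show "\<not> crosses (E - H) {v. v < n \<and> l2 v = z}"
          proof (cases "z = x")
            case True
            then have "{v. v < n \<and> l2 v = z} = {}" using ab by (auto simp: l2_def)
            then show ?thesis by (simp add: crosses_def)
          next
            case False
            then have c: "\<not> crosses (E - H) {v. v < n \<and> l v = z}" using z E Cons.prems(4) by auto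
            have "z \<noteq> l b"
            proof
              assume "z = l b"
              then have "crosses (E - H) {v. v < n \<and> l v = z}"
                unfolding crosses_def using ab
                by (intro exI[of _ b] exI[of _ a]) (auto simp: insert_commute)
              then show False using c by blast
            qed
            then have "{v. v < n \<and> l2 v = z} = {v. v < n \<and> l v = z}"
              using False ab by (auto simp: l2_def)
            then show ?thesis using c by simp
          qed
        qed (use Cons.prems in auto)
        show "solves ?G' ((3 + 6 * L) * length xs) P"
        proof (rule solves_bind'[OF rec, where q' = 0])
          fix s :: "(nat \<Rightarrow> nat) \<times> nat set set"
          obtain l' F where s: "s = (l', F)" by fastforce
          show "solves {E \<in> ?G'. Q E s} 0 P"
          proof (rule solves_return[where x = "(l', insert {a, b} F)"])
            fix E assume "E \<in> {E \<in> ?G'. Q E s}"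
            then have E: "E \<in> ?G'" and QE: "Q E (l', F)" by (auto simp: s)
            have ab: "a < n" "b < n" "l a = x" "l b \<noteq> x" "{a, b} \<in> E - H"
              using E by (auto simp: p A_def B_def)
            have img: "l2 ` {..<n} \<subseteq> l ` {..<n}" using ab by (auto simp: l2_def)
            have "sat n l' T" if T: "sat n l T" "\<not> crosses (insert {a, b} F) T" for T
            proof -
              have "a \<in> T \<longleftrightarrow> b \<in> T" using T(2) unfolding crosses_def
                by (metis insert_commute insertI1)
              then have "sat n l2 T" unfolding l2_def using sat_merge[OF T(1) ab(1,2)] by auto
              moreover have "\<not> crosses F T" using T(2) unfolding crosses_def by blast
              ultimately show ?thesis using QE by (auto simp: Q_def)
            qed
            moreover have "l' ` {..<n} \<subseteq> l ` {..<n}"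
              using QE img unfolding Q_def prod.case by (meson subset_trans)
            ultimately show "P E (l', insert {a, b} F)"
              using QE ab(5) unfolding P_def Q_def by simp
          qed
        qed auto
      qed
    qed
  qed auto
  then show ?case unfolding P_def .
qed

text \<open>Each colour is handled once, at the price of one test and at most one edge search.
  Afterwards every fibre of \<open>l'\<close> is closed, and a union of fibres of \<open>l\<close>
  that \<open>F\<close> does not cross is a union of fibres of \<open>l'\<close>; hence no edge of
  \<open>E - H\<close> leaves it. So \<open>F\<close> acts as a maximal spanning forest of the
  contracted remainder.\<close>

lemma forest_round:
  assumes "G \<subseteq> graphs n" "n \<le> 2 ^ L" "\<And>E. E \<in> G \<Longrightarrow> H \<subseteq> E"
  shows "solves G ((3 + 6 * L) * card (l ` {..<n}))
    (\<lambda>E F. F \<subseteq> E - H \<and> (\<forall>T. sat n l T \<and> \<not> crosses F T \<longrightarrow> \<not> crosses (E - H) T))"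
proof -
  let ?xs = "sorted_list_of_set (l ` {..<n})"
  show ?thesis
  proof (rule solves_bind'[OF forest_loop[OF assms, where D = "{}" and l = l and xs = ?xs], where q' = 0])
    fix s :: "(nat \<Rightarrow> nat) \<times> nat set set"
    obtain l' F where s: "s = (l', F)" by fastforce
    show "solves {E \<in> G. case s of (l', F) \<Rightarrow> F \<subseteq> E - H \<and> l' ` {..<n} \<subseteq> l ` {..<n} \<and>
       (\<forall>T. sat n l T \<and> \<not> crosses F T \<longrightarrow> sat n l' T) \<and>
       (\<forall>x\<in>{} \<union> set ?xs. \<not> crosses (E - H) {v. v < n \<and> l' v = x})} 0
     (\<lambda>E F. F \<subseteq> E - H \<and> (\<forall>T. sat n l T \<and> \<not> crosses F T \<longrightarrow> \<not> crosses (E - H) T))"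
    proof (rule solves_return[where x = F], intro conjI allI impI)
      fix E assume "E \<in> {E \<in> G. case s of (l', F) \<Rightarrow> F \<subseteq> E - H \<and> l' ` {..<n} \<subseteq> l ` {..<n} \<and>
       (\<forall>T. sat n l T \<and> \<not> crosses F T \<longrightarrow> sat n l' T) \<and>
       (\<forall>x\<in>{} \<union> set ?xs. \<not> crosses (E - H) {v. v < n \<and> l' v = x})}"
      then have E: "E \<in> G" "F \<subseteq> E - H" "l' ` {..<n} \<subseteq> l ` {..<n}"
        "\<And>T. sat n l T \<Longrightarrow> \<not> crosses F T \<Longrightarrow> sat n l' T"
        "\<And>x. x \<in> l ` {..<n} \<Longrightarrow> \<not> crosses (E - H) {v. v < n \<and> l' v = x}"
        by (auto simp: s)
      show "F \<subseteq> E - H" by fact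
      fix T assume T: "sat n l T \<and> \<not> crosses F T"
      then have T': "sat n l' T" using E by blast
      show "\<not> crosses (E - H) T"
      proof
        assume "crosses (E - H) T"
        then obtain a b where ab: "{a, b} \<in> E - H" "a \<in> T" "b \<notin> T" by (auto simp: crosses_def)
        have "E \<in> graphs n" using E assms by auto
        then have abn: "a < n" "b < n" using ab graphsD by blast+
        have "\<not> crosses (E - H) {v. v < n \<and> l' v = l' a}" using E(3,5) abn by blast
        then have "l' b = l' a" using ab abn unfolding crosses_def by blast
        then show False using T' ab abn unfolding sat_def by metis
      qed
    qed
  qed auto
qed

text \<open>A sparse certificate of Nagamochi-Ibaraki type: a cut that still has an edge outside
  \<open>H\<close> is crossed by the next forest, so every round raises its value in
  \<open>H\<close> by at least one.\<close>

lemma sparse_certificate: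
  assumes "G \<subseteq> graphs n" "n \<le> 2 ^ L"
  shows "solves G (d * ((3 + 6 * L) * card (l ` {..<n})))
    (\<lambda>E H. H \<subseteq> E \<and> (\<forall>T. sat n l T \<and> crosses (E - H) T \<longrightarrow> d \<le> cut_val H T))"
proof (induction d)
  case 0
  show ?case by (rule solves_return[where x = "{}"]) auto
next
  case (Suc d)
  show ?case
  proof (rule solves_bind'[OF Suc.IH, where q' = "(3 + 6 * L) * card (l ` {..<n})"])
    fix H
    let ?G = "{E \<in> G. H \<subseteq> E \<and> (\<forall>T. sat n l T \<and> crosses (E - H) T \<longrightarrow> d \<le> cut_val H T)}"
    have round: "solves ?G ((3 + 6 * L) * card (l ` {..<n}))
      (\<lambda>E F. F \<subseteq> E - H \<and> (\<forall>T. sat n l T \<and> \<not> crosses F T \<longrightarrow> \<not> crosses (E - H) T))"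
      by (rule forest_round) (use assms in auto)
    show "solves ?G ((3 + 6 * L) * card (l ` {..<n}))
      (\<lambda>E H. H \<subseteq> E \<and> (\<forall>T. sat n l T \<and> crosses (E - H) T \<longrightarrow> Suc d \<le> cut_val H T))"
    proof (rule solves_bind'[OF round, where q' = 0])
      fix F
      show "solves {E \<in> ?G. F \<subseteq> E - H \<and> (\<forall>T. sat n l T \<and> \<not> crosses F T \<longrightarrow> \<not> crosses (E - H) T)} 0
        (\<lambda>E H. H \<subseteq> E \<and> (\<forall>T. sat n l T \<and> crosses (E - H) T \<longrightarrow> Suc d \<le> cut_val H T))"
      proof (rule solves_return[where x = "H \<union> F"], intro conjI allI impI)
        fix E assume E: "E \<in> {E \<in> ?G. F \<subseteq> E - H \<and>
          (\<forall>T. sat n l T \<and> \<not> crosses F T \<longrightarrow> \<not> crosses (E - H) T)}"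
        show "H \<union> F \<subseteq> E" using E by auto
        then have HF: "H \<union> F \<in> graphs n" using E assms graphs_subset by blast
        fix T assume T: "sat n l T \<and> crosses (E - (H \<union> F)) T"
        then have "crosses (E - H) T" by (auto simp: crosses_def)
        then have "d \<le> cut_val H T" "crosses F T" using E T by auto
        moreover have "H \<union> F - H = F" using E by auto
        moreover have "F \<in> graphs n" using HF graphs_subset by blast
        ultimately show "Suc d \<le> cut_val (H \<union> F) T"
          using cut_val_diff[OF HF, of H T] crosses_iff[of F n T] by auto
      qed
    qed auto
  qed auto
qed

text \<open>A minimiser \<open>T\<close> of the value in the known \<open>H\<close> costs no further
  queries. It satisfies c_H(\<open>T\<close>) \<le> c_H(\<open>S\<close>) \<le>
  c_E(\<open>S\<close>) < \<open>d\<close>, so by the certificate no edge across \<open>T\<close> is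
  missing from \<open>H\<close>, and c_E(\<open>T\<close>) = c_H(\<open>T\<close>) \<le>
  c_E(\<open>S\<close>).\<close>

lemma contracted_min_cut:
  assumes "G \<subseteq> graphs n" "n \<le> 2 ^ L" "2 \<le> n"
  shows "solves G (d * ((3 + 6 * L) * card (l ` {..<n})))
    (\<lambda>E T. T \<noteq> {} \<and> T \<subset> {..<n} \<and>
      (\<forall>S. is_global_min_cut n E S \<and> sat n l S \<and> cut_val E S < d \<longrightarrow> is_global_min_cut n E T))"
proof (rule solves_bind'[OF sparse_certificate[OF assms(1,2)], where q' = 0])
  fix H
  let ?G = "{E \<in> G. H \<subseteq> E \<and> (\<forall>T. sat n l T \<and> crosses (E - H) T \<longrightarrow> d \<le> cut_val H T)}"
  define V where "V T \<longleftrightarrow> T \<noteq> {} \<and> T \<subset> {..<n} \<and> sat n l T" for T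
  show "solves ?G 0 (\<lambda>E T. T \<noteq> {} \<and> T \<subset> {..<n} \<and>
      (\<forall>S. is_global_min_cut n E S \<and> sat n l S \<and> cut_val E S < d \<longrightarrow> is_global_min_cut n E T))"
  proof (cases "\<exists>T. V T")
    case False
    \<comment> \<open>Without a proper union of fibres there is no \<open>S\<close> to recover, and
      \<open>{0}\<close> is merely some legal cut.\<close>
    have "Suc 0 \<in> {..<n} - {0}" "0 \<in> {..<n}" using assms(3) by auto
    then have "{0} \<subset> {..<n}" by blast
    then show ?thesis
      by (intro solves_return[where x = "{0}"]) (use False in \<open>auto simp: V_def is_global_min_cut_def\<close>)
  next
    case True
    then obtain T0 where "V T0" ..
    define T where "T = arg_min (cut_val H) V"
    have T: "V T" "\<And>S. V S \<Longrightarrow> cut_val H T \<le> cut_val H S"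
      using arg_min_nat_lemma[of V T0 "cut_val H"] \<open>V T0\<close> by (auto simp: T_def)
    show ?thesis
    proof (rule solves_return[where x = T], intro conjI allI impI)
      fix E assume E: "E \<in> ?G"
      show "T \<noteq> {}" "T \<subset> {..<n}" using T by (auto simp: V_def)
      fix S assume S: "is_global_min_cut n E S \<and> sat n l S \<and> cut_val E S < d"
      have En: "E \<in> graphs n" "H \<subseteq> E" "E - H \<in> graphs n" using E assms graphs_subset by blast+
      have le: "cut_val H T \<le> cut_val H S" using S by (intro T(2)) (auto simp: V_def is_global_min_cut_def)
      have HS: "cut_val H S \<le> cut_val E S" using cut_val_diff[OF En(1,2), of S] by auto
      then have "\<not> crosses (E - H) T" using E T(1) le S unfolding V_def by force
      then have "cut_val E T = cut_val H T"
        using cut_val_diff[OF En(1,2), of T] crosses_iff[OF En(3), of T] by auto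
      then have "cut_val E T \<le> cut_val E S" using le HS by auto
      then show "is_global_min_cut n E T"
        using S T(1) unfolding is_global_min_cut_def V_def by (meson le_trans)
    qed
  qed
qed auto

section \<open>Star contraction\<close>

lemma arcs_singleton: "arcs E {v} B = card (nbrs E v \<inter> B)"
  unfolding arcs_def nbrs_def
  by (rule bij_betw_same_card[of snd], rule bij_betwI[where g = "Pair v"]) auto

lemma nbrs_subset: "E \<in> graphs n \<Longrightarrow> nbrs E v \<subseteq> {..<n} - {v}"
  by (auto simp: nbrs_def dest: graphsD(2) graphsD(3)[of E n v v])

text \<open>The number of neighbours in \<open>R\<close> below a bound is monotone in the bound, at
  most \<open>m\<close> at \<open>lo\<close> and above \<open>m\<close> at
  \<open>lo + 2 ^ i\<close>. The count at the midpoint tells which half inherits this; an interval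
  of length one holds the neighbour sought.\<close>

lemma solves_element_of_rank:
  assumes "G \<subseteq> graphs n" "R \<subseteq> {..<n}" "v < n" "v \<notin> R"
    "\<And>E. E \<in> G \<Longrightarrow> card (nbrs E v \<inter> R \<inter> {..<lo}) \<le> m \<and> m < card (nbrs E v \<inter> R \<inter> {..<lo + 2 ^ i})"
  shows "solves G (3 * i) (\<lambda>E w. w \<in> nbrs E v \<inter> R \<and> card (nbrs E v \<inter> R \<inter> {..<w}) = m)"
  using assms
proof (induction i arbitrary: G lo)
  case 0
  show ?case
  proof (rule solves_return[where x = lo])
    fix E assume "E \<in> G"
    then have c: "card (nbrs E v \<inter> R \<inter> {..<lo}) \<le> m" "m < card (nbrs E v \<inter> R \<inter> {..<Suc lo})"
      using 0(5) by auto
    have "lo \<in> nbrs E v \<inter> R"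
    proof (rule ccontr)
      assume "lo \<notin> nbrs E v \<inter> R"
      then have "nbrs E v \<inter> R \<inter> {..<Suc lo} = nbrs E v \<inter> R \<inter> {..<lo}" by (auto simp: less_Suc_eq)
      then show False using c by simp
    qed
    moreover from this have "nbrs E v \<inter> R \<inter> {..<Suc lo} = insert lo (nbrs E v \<inter> R \<inter> {..<lo})"
      by (auto simp: less_Suc_eq)
    ultimately show "lo \<in> nbrs E v \<inter> R \<and> card (nbrs E v \<inter> R \<inter> {..<lo}) = m"
      using c by simp
  qed
next
  case (Suc i)
  define mid where "mid = lo + 2 ^ i"
  show ?case
  proof (rule solves_bind'[OF solves_arcs[OF Suc.prems(1), of "{v}" "R \<inter> {..<mid}"], where q' = "3 * i"])
    fix y
    show "solves {E \<in> G. y = arcs E {v} (R \<inter> {..<mid})} (3 * i)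
      (\<lambda>E w. w \<in> nbrs E v \<inter> R \<and> card (nbrs E v \<inter> R \<inter> {..<w}) = m)"
    proof (cases "m < y")
      case True
      show ?thesis
        by (rule Suc.IH[where lo = lo])
          (use Suc.prems True in \<open>auto simp: arcs_singleton mid_def Int_assoc\<close>)
    next
      case False
      show ?thesis
        by (rule Suc.IH[where lo = mid])
          (use Suc.prems False in \<open>auto simp: arcs_singleton mid_def Int_assoc mult_2 add.assoc\<close>)
    qed
  qed (use Suc.prems in auto)
qed

lemma rank_inj:
  fixes A :: "nat set"
  assumes "w \<in> A" "w' \<in> A" "card (A \<inter> {..<w}) = card (A \<inter> {..<w'})"
  shows "w = w'"
proof -
  have aux: "card (A \<inter> {..<x}) < card (A \<inter> {..<y})" if "x < y" "x \<in> A" for x y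
    by (rule psubset_card_mono) (use that in auto)
  show ?thesis using aux[of w w'] aux[of w' w] assms by (metis less_irrefl nat_neq_iff)
qed

text \<open>Naming a centre by its rank among the neighbouring centres serves two ends: the rank can
  be located by bisection, and \<open>u\<close> modulo their number is uniform for a suitable random
  \<open>u\<close>.\<close>

definition star_label :: "nat set set \<Rightarrow> nat set \<Rightarrow> nat \<Rightarrow> nat \<Rightarrow> nat" where
  "star_label E R u v = (if v \<in> R \<or> nbrs E v \<inter> R = {} then v
     else THE w. w \<in> nbrs E v \<inter> R \<and> card (nbrs E v \<inter> R \<inter> {..<w}) = u mod card (nbrs E v \<inter> R))"

lemma star_label_eqI:
  assumes "v \<notin> R" "w \<in> nbrs E v \<inter> R" "card (nbrs E v \<inter> R \<inter> {..<w}) = u mod card (nbrs E v \<inter> R)"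
  shows "star_label E R u v = w"
proof -
  have "(THE w. w \<in> nbrs E v \<inter> R \<and> card (nbrs E v \<inter> R \<inter> {..<w}) = u mod card (nbrs E v \<inter> R)) = w"
    by (rule the_equality) (use assms rank_inj[of _ "nbrs E v \<inter> R"] in auto)
  then show ?thesis using assms by (auto simp: star_label_def)
qed

lemma solves_star_label:
  assumes G: "G \<subseteq> graphs n" "R \<subseteq> {..<n}" "v < n" "n \<le> 2 ^ L"
  shows "solves G (3 + 3 * L) (\<lambda>E w. w = star_label E R u v)"
proof (cases "v \<in> R")
  case True
  then show ?thesis by (intro solves_return[where x = v]) (auto simp: star_label_def)
next
  case False
  show ?thesis
  proof (rule solves_bind[OF solves_arcs[OF G(1), of "{v}" R]])
    fix y
    let ?G = "{E \<in> G. y = arcs E {v} R}"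
    have fin: "finite (nbrs E v \<inter> R)" for E using G(2) finite_subset by blast
    show "solves ?G (3 * L) (\<lambda>E w. w = star_label E R u v)"
    proof (cases "y = 0")
      case True
      show ?thesis
        by (rule solves_return[where x = v])
          (use True fin in \<open>auto simp: arcs_singleton star_label_def\<close>)
    next
      case y: False
      have "solves ?G (3 * L) (\<lambda>E w. w \<in> nbrs E v \<inter> R \<and> card (nbrs E v \<inter> R \<inter> {..<w}) = u mod y)"
      proof (rule solves_element_of_rank[where lo = 0, OF _ G(2,3) False])
        fix E assume "E \<in> ?G"
        moreover have "nbrs E v \<inter> R \<inter> {..<0 + 2 ^ L} = nbrs E v \<inter> R" using G by auto
        ultimately show "card (nbrs E v \<inter> R \<inter> {..<0}) \<le> u mod y \<and>
          u mod y < card (nbrs E v \<inter> R \<inter> {..<0 + 2 ^ L})"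
          using y by (auto simp: arcs_singleton)
      qed (use G in auto)
      then show ?thesis
        by (rule solves_mono) (use False in \<open>auto simp: arcs_singleton star_label_eqI\<close>)
    qed
  qed (use False G in auto)
qed

section \<open>Parameters and query cost of one star contraction\<close>

definition min_degree :: "nat \<Rightarrow> nat set set \<Rightarrow> nat" where
  "min_degree n E = Min ((\<lambda>v. cut_val E {v}) ` {..<n})"

text \<open>
  A vertex becomes a centre when its random rank in \<open>{..<n}\<close> is below \<open>j\<close>, so that \<open>j\<close> is the expected
  number of centres and every vertex sees at least about \<open>20 * L\<close> of them. For \<open>d = 0\<close> this is \<open>1\<close>, which
  is harmless since then a singleton is a minimum cut.
\<close>

definition num_centres :: "nat \<Rightarrow> nat \<Rightarrow> nat \<Rightarrow> nat" where
  "num_centres n L d = 20 * n * L div d + 1"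

definition centres :: "nat \<Rightarrow> nat \<Rightarrow> (nat \<Rightarrow> nat) \<Rightarrow> nat set" where
  "centres n j t = {v. v < n \<and> t v < j}"

text \<open>Void if the value of \<open>S\<close> reaches the minimum degree, since then a singleton
  is optimal. The bound on the number of fibres belongs to the event because the query bound must
  hold for every seed: a run with more fibres is given up.\<close>

definition star_contraction_succeeds ::
  "nat \<Rightarrow> nat \<Rightarrow> nat set set \<Rightarrow> (nat \<Rightarrow> nat) \<times> (nat \<Rightarrow> nat) \<Rightarrow> bool" where
  "star_contraction_succeeds n L E w \<longleftrightarrow>
    (let j = num_centres n L (min_degree n E);
         l = (\<lambda>v. star_label E (centres n j (fst w)) (snd w v) v)
     in \<exists>S. is_global_min_cut n E S \<and>
       (cut_val E S < min_degree n E \<longrightarrow> sat n l S \<and> card (l ` {..<n}) \<le> 8 * j))"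

lemma cut_val_singleton:
  assumes "E \<in> graphs n"
  shows "cut_val E {v} = card (nbrs E v)"
proof -
  have "nbrs E v \<inter> ({..<n} - {v}) = nbrs E v" using nbrs_subset[OF assms] by blast
  then show ?thesis using cut_val_arcs[OF assms] by (simp add: arcs_singleton)
qed

lemma cut_val_singleton_le:
  assumes "E \<in> graphs n"
  shows "cut_val E {v} \<le> n"
  using card_mono[of "{..<n}" "nbrs E v"] nbrs_subset[OF assms, of v]
  unfolding cut_val_singleton[OF assms] by auto

lemma is_global_min_cut_le:
  assumes "is_global_min_cut n E S" "T \<noteq> {}" "T \<subset> {..<n}" "cut_val E T \<le> cut_val E S"
  shows "is_global_min_cut n E T"
  using assms unfolding is_global_min_cut_def by (meson le_trans)

lemma singleton_psubset:
  fixes n v :: nat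
  assumes "2 \<le> n" "v < n"
  shows "{v} \<subset> {..<n}"
proof -
  have "(if v = 0 then 1 else 0) \<in> {..<n} - {v}" "v \<in> {..<n}" using assms by auto
  then show ?thesis by blast
qed

text \<open>The minimum degree is read off from \<open>n\<close> singleton queries, and labels take
  \<open>3 + 3 * L\<close> queries per vertex. The forests dominate: \<open>d\<close> rounds on at
  most \<open>8 * j\<close> fibres, where \<open>d * j\<close> is at most
  \<open>20 * n * L + n\<close>.\<close>

lemma solves_star_contraction:
  assumes n: "2 \<le> n" "n \<le> 2 ^ L" "1 \<le> L"
  shows "solves (graphs n) (1520 * n * L\<^sup>2)
    (\<lambda>E T. T \<noteq> {} \<and> T \<subset> {..<n} \<and>
       (star_contraction_succeeds n L E w \<longrightarrow> is_global_min_cut n E T))"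
    (is "solves _ _ ?P")
proof -
  have "solves (graphs n) (1 * length [0..<n]) (\<lambda>E f. \<forall>v\<in>set [0..<n]. f v = cut_val E {v})"
    by (rule solves_map) (rule solves_cut_val)
  then show ?thesis
  proof (rule solves_bind'[where q' = "(3 + 3 * L) * n + (8 * (3 + 6 * L) * (20 * n * L + n) + 1)"])
    fix f
    define G1 where "G1 = {E \<in> graphs n. \<forall>v\<in>set [0..<n]. f v = cut_val E {v}}"
    define d where "d = Min (f ` {..<n})"
    define j where "j = num_centres n L d"
    define R where "R = centres n j (fst w)"
    have Rn: "R \<subseteq> {..<n}" by (auto simp: R_def centres_def)
    have "d \<in> f ` {..<n}" unfolding d_def using n by (intro Min_in) (auto simp: lessThan_empty_iff)
    then obtain v0 where v0: "v0 < n" "f v0 = d" by auto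
    note v0sub = singleton_psubset[OF n(1) v0(1)]
    have G1: "min_degree n E = d" "cut_val E {v0} = d" "d \<le> n" "E \<in> graphs n" if "E \<in> G1" for E
    proof -
      have f: "f v = cut_val E {v}" if "v < n" for v using \<open>E \<in> G1\<close> that by (auto simp: G1_def)
      then have "(\<lambda>v. cut_val E {v}) ` {..<n} = f ` {..<n}" by auto
      then show "min_degree n E = d" by (simp add: min_degree_def d_def)
      show E: "E \<in> graphs n" using that by (simp add: G1_def)
      show "cut_val E {v0} = d" using f v0 by auto
      then show "d \<le> n" using cut_val_singleton_le[OF E] by metis
    qed
    have lab: "solves G1 ((3 + 3 * L) * length [0..<n])
      (\<lambda>E g. \<forall>v\<in>set [0..<n]. g v = star_label E R (snd w v) v)"
      by (rule solves_map, rule solves_star_label) (use n Rn in \<open>auto simp: G1_def\<close>)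
    have "solves G1 ((3 + 3 * L) * n + (8 * (3 + 6 * L) * (20 * n * L + n) + 1)) ?P"
    proof (rule solves_bind'[OF lab])
      fix g
      define G2 where "G2 = {E \<in> G1. \<forall>v\<in>set [0..<n]. g v = star_label E R (snd w v) v}"
      have G2: "min_degree n E = d" "cut_val E {v0} = d" "d \<le> n" "E \<in> graphs n"
        "star_contraction_succeeds n L E w \<longleftrightarrow> (\<exists>S. is_global_min_cut n E S \<and>
          (cut_val E S < d \<longrightarrow> sat n g S \<and> card (g ` {..<n}) \<le> 8 * j))"
        if "E \<in> G2" for E
      proof -
        have "E \<in> G1" using that by (auto simp: G2_def)
        note * = G1[OF this]
        show "min_degree n E = d" "cut_val E {v0} = d" "d \<le> n" "E \<in> graphs n" by fact+
        let ?l = "\<lambda>v. star_label E (centres n j (fst w)) (snd w v) v"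
        have g: "g v = ?l v" if "v < n" for v using \<open>E \<in> G2\<close> that by (auto simp: G2_def R_def)
        then have "sat n g S = sat n ?l S" for S by (auto simp: sat_def)
        moreover have "g ` {..<n} = ?l ` {..<n}" using g by auto
        ultimately show "star_contraction_succeeds n L E w \<longleftrightarrow> (\<exists>S. is_global_min_cut n E S \<and>
          (cut_val E S < d \<longrightarrow> sat n g S \<and> card (g ` {..<n}) \<le> 8 * j))"
          unfolding star_contraction_succeeds_def *(1) j_def[symmetric] Let_def by simp
      qed
      have v0_min: "is_global_min_cut n E {v0}"
        if "E \<in> G2" "is_global_min_cut n E S" "d \<le> cut_val E S" for E S
        using is_global_min_cut_le[OF that(2) _ v0sub] G2[OF that(1)] that(3) by auto
      have "solves G2 (8 * (3 + 6 * L) * (20 * n * L + n) + 1) ?P"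
      proof (cases "G2 = {} \<or> card (g ` {..<n}) > 8 * j")
        case True
        \<comment> \<open>With too many fibres, success is possible only through a minimum cut of
          value at least \<open>d\<close>, for which \<open>{v0}\<close> is a correct
          answer.\<close>
        show ?thesis
          by (rule solves_return[where x = "{v0}"])
            (use True G2 v0_min v0sub in \<open>force simp: not_le[symmetric]\<close>)
      next
        case False
        then have dn: "d \<le> n" and r: "card (g ` {..<n}) \<le> 8 * j" using G2(3) by auto
        have "d * j \<le> 20 * n * L + n"
        proof -
          \<comment> \<open>The factor \<open>d\<close> cancels against the division in
            \<open>num_centres\<close>; the summand \<open>1\<close> there costs \<open>d\<close>,
            which is at most \<open>n\<close>.\<close>
          have "d * (20 * n * L div d) \<le> 20 * n * L" by (rule times_div_less_eq_dividend)
          moreover have "d * j = d * (20 * n * L div d) + d" by (simp add: j_def num_centres_def)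
          ultimately show ?thesis using dn by linarith
        qed
        then have *: "(8 * (3 + 6 * L)) * (d * j) \<le> (8 * (3 + 6 * L)) * (20 * n * L + n)"
          by (rule mult_le_mono2)
        have "d * ((3 + 6 * L) * card (g ` {..<n})) \<le> d * ((3 + 6 * L) * (8 * j))"
          using r by (intro mult_le_mono le_refl)
        also have "\<dots> = (8 * (3 + 6 * L)) * (d * j)" by (simp only: mult_ac)
        also note *
        finally have cost: "d * ((3 + 6 * L) * card (g ` {..<n})) + 1
            \<le> 8 * (3 + 6 * L) * (20 * n * L + n) + 1" by linarith
        have "solves G2 (d * ((3 + 6 * L) * card (g ` {..<n})))
          (\<lambda>E T. T \<noteq> {} \<and> T \<subset> {..<n} \<and>
          (\<forall>S. is_global_min_cut n E S \<and> sat n g S \<and> cut_val E S < d \<longrightarrow> is_global_min_cut n E T))"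
          by (rule contracted_min_cut) (use G2 n in auto)
        then show ?thesis
        proof (rule solves_bind'[OF _ _ cost])
          fix T
          let ?G = "{E \<in> G2. T \<noteq> {} \<and> T \<subset> {..<n} \<and>
            (\<forall>S. is_global_min_cut n E S \<and> sat n g S \<and> cut_val E S < d \<longrightarrow> is_global_min_cut n E T)}"
          show "solves ?G 1 ?P"
          proof (rule solves_bind'[OF solves_cut_val[of _ T], where q' = 0])
            fix y
            show "solves {E \<in> ?G. y = cut_val E T} 0 ?P"
            \<comment> \<open>A value below \<open>d\<close> beats every singleton; otherwise
              \<open>{v0}\<close>, of value \<open>d\<close>, is the safe answer.\<close>
            proof (rule solves_return[where x = "if y < d then T else {v0}"], intro conjI impI)
              fix E assume E: "E \<in> {E \<in> ?G. y = cut_val E T}"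
              then have E2: "E \<in> G2" and y: "y = cut_val E T" and T: "T \<noteq> {}" "T \<subset> {..<n}" by auto
              show "(if y < d then T else {v0}) \<noteq> {}" "(if y < d then T else {v0}) \<subset> {..<n}"
                using T v0sub by auto
              assume "star_contraction_succeeds n L E w"
              then obtain S where S: "is_global_min_cut n E S"
                "cut_val E S < d \<Longrightarrow> sat n g S \<and> card (g ` {..<n}) \<le> 8 * j"
                using G2(5)[OF E2] by blast
              show "is_global_min_cut n E (if y < d then T else {v0})"
              proof (cases "cut_val E S < d")
                case True
                then have Tm: "is_global_min_cut n E T" using E S by auto
                then have "cut_val E T \<le> cut_val E S"
                  using S(1) by (auto simp: is_global_min_cut_def)
                then show ?thesis using Tm True y by auto
              next
                case False
                then have v0m: "is_global_min_cut n E {v0}" using v0_min[OF E2 S(1)] by auto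
                then have "y < d \<Longrightarrow> is_global_min_cut n E T"
                  using is_global_min_cut_le[OF v0m T] y G2(2)[OF E2] by auto
                then show ?thesis using v0m by auto
              qed
            qed
          qed auto
        qed
      qed
      then show "solves {E \<in> G1. \<forall>v\<in>set [0..<n]. g v = star_label E R (snd w v) v}
         (8 * (3 + 6 * L) * (20 * n * L + n) + 1) ?P" unfolding G2_def .
    qed auto
    then show "solves {E \<in> graphs n. \<forall>v\<in>set [0..<n]. f v = cut_val E {v}}
      ((3 + 3 * L) * n + (8 * (3 + 6 * L) * (20 * n * L + n) + 1)) ?P" unfolding G1_def .
  next
    have LL: "L \<le> L\<^sup>2" "1 \<le> L\<^sup>2" using n(3) by (auto simp: power2_eq_square)
    then have "n * L \<le> n * L\<^sup>2" "n * 1 \<le> n * L\<^sup>2" by (intro mult_le_mono2; simp)+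
    \<comment> \<open>The constant 1520 is 28 + 531 + 960 + 1, each term being bounded by its
      multiple of \<open>n * L\<^sup>2\<close>.\<close>
    moreover have "1 * length [0..<n] + ((3 + 3 * L) * n + (8 * (3 + 6 * L) * (20 * n * L + n) + 1))
      = 28 * n + 531 * (n * L) + 960 * (n * L\<^sup>2) + 1"
      by (simp add: algebra_simps power2_eq_square)
    moreover have "1520 * n * L\<^sup>2 = 1520 * (n * L\<^sup>2)" by simp
    ultimately show "1 * length [0..<n] +
      ((3 + 3 * L) * n + (8 * (3 + 6 * L) * (20 * n * L + n) + 1)) \<le> 1520 * n * L\<^sup>2"
      using n(1) by linarith
  qed
qed

text \<open>All candidates are legal cuts, so the cheaper of two is a minimum cut as soon as one of
  them is. The two extra queries per candidate make this comparison.\<close>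

lemma solves_best_of:
  assumes "2 \<le> n" "\<And>w. w \<in> set ws \<Longrightarrow> solves (graphs n) q
    (\<lambda>E T. T \<noteq> {} \<and> T \<subset> {..<n} \<and> (P E w \<longrightarrow> is_global_min_cut n E T))"
  shows "solves (graphs n) ((q + 2) * length ws)
    (\<lambda>E T. T \<noteq> {} \<and> T \<subset> {..<n} \<and> ((\<exists>w\<in>set ws. P E w) \<longrightarrow> is_global_min_cut n E T))"
  using assms(2)
proof (induction ws)
  case Nil
  show ?case
    by (rule solves_return[where x = "{0}"]) (use singleton_psubset[OF assms(1), of 0] assms(1) in auto)
next
  case (Cons w ws)
  let ?A = "\<lambda>E T. T \<noteq> {} \<and> T \<subset> {..<n} \<and> ((\<exists>w\<in>set ws. P E w) \<longrightarrow> is_global_min_cut n E T)"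
  let ?B = "\<lambda>E T. T \<noteq> {} \<and> T \<subset> {..<n} \<and> (P E w \<longrightarrow> is_global_min_cut n E T)"
  let ?C = "\<lambda>E T. T \<noteq> {} \<and> T \<subset> {..<n} \<and> ((\<exists>w\<in>set (w # ws). P E w) \<longrightarrow> is_global_min_cut n E T)"
  have IH: "solves (graphs n) ((q + 2) * length ws) ?A" using Cons by auto
  have W: "solves (graphs n) q ?B" using Cons by auto
  show ?case
  proof (rule solves_bind'[OF IH, where q' = "q + 2"])
    fix T1
    let ?G1 = "{E \<in> graphs n. ?A E T1}"
    have "solves ?G1 q ?B" by (rule solves_mono[OF W]) auto
    then show "solves ?G1 (q + 2) ?C"
    proof (rule solves_bind)
      fix T2
      let ?G2 = "{E \<in> ?G1. ?B E T2}"
      show "solves ?G2 2 ?C"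
      proof (rule solves_bind'[OF solves_cut_val[of _ T1], where q' = 1])
        fix y1
        show "solves {E \<in> ?G2. y1 = cut_val E T1} 1 ?C"
        proof (rule solves_bind'[OF solves_cut_val[of _ T2], where q' = 0])
          fix y2
          show "solves {E \<in> {E \<in> ?G2. y1 = cut_val E T1}. y2 = cut_val E T2} 0 ?C"
          proof (rule solves_return[where x = "if y1 \<le> y2 then T1 else T2"], intro conjI impI)
            fix E assume E: "E \<in> {E \<in> {E \<in> ?G2. y1 = cut_val E T1}. y2 = cut_val E T2}"
            let ?T = "if y1 \<le> y2 then T1 else T2"
            show T: "?T \<noteq> {}" "?T \<subset> {..<n}" using E by auto
            have le: "cut_val E ?T \<le> cut_val E T1" "cut_val E ?T \<le> cut_val E T2" using E by auto
            assume "\<exists>w\<in>set (w # ws). P E w"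
            then have "is_global_min_cut n E T1 \<or> is_global_min_cut n E T2" using E by auto
            then show "is_global_min_cut n E ?T"
              using is_global_min_cut_le[OF _ T le(1)] is_global_min_cut_le[OF _ T le(2)] by blast
          qed
        qed auto
      qed auto
    qed
  qed auto
qed

section \<open>Neighbourhoods across a minimum cut\<close>

lemma arcs_sum:
  assumes "finite A" "E \<in> graphs n"
  shows "arcs E A B = (\<Sum>a\<in>A. card (nbrs E a \<inter> B))"
proof -
  have fin: "finite (nbrs E a)" for a using nbrs_subset[OF assms(2)] finite_subset by blast
  have "{(a, b). a \<in> A \<and> b \<in> B \<and> {a, b} \<in> E} = (SIGMA a:A. nbrs E a \<inter> B)"
    by (auto simp: nbrs_def)
  then show ?thesis unfolding arcs_def using assms(1) fin by simp
qed

definition cross_nbrs :: "nat set set \<Rightarrow> nat set \<Rightarrow> nat \<Rightarrow> nat set" where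
  "cross_nbrs E S v = {w \<in> nbrs E v. (w \<in> S) \<noteq> (v \<in> S)}"

text \<open>Each crossing edge is seen from both of its ends.\<close>

lemma sum_card_cross_nbrs:
  assumes E: "E \<in> graphs n" and S: "S \<subseteq> {..<n}"
  shows "(\<Sum>v<n. card (cross_nbrs E S v)) = 2 * cut_val E S"
proof -
  have fin: "finite S" using S finite_subset by blast
  have "(\<Sum>v<n. card (cross_nbrs E S v)) =
      (\<Sum>v\<in>S. card (cross_nbrs E S v)) + (\<Sum>v\<in>{..<n} - S. card (cross_nbrs E S v))"
    using S by (simp add: sum.subset_diff add.commute)
  also have "(\<Sum>v\<in>S. card (cross_nbrs E S v)) = (\<Sum>v\<in>S. card (nbrs E v \<inter> ({..<n} - S)))"
    by (intro sum.cong refl arg_cong[where f = card])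
      (use nbrs_subset[OF E] in \<open>auto simp: cross_nbrs_def\<close>)
  also have "\<dots> = arcs E S ({..<n} - S)" using arcs_sum[OF fin E] by simp
  also have "(\<Sum>v\<in>{..<n} - S. card (cross_nbrs E S v)) = (\<Sum>v\<in>{..<n} - S. card (nbrs E v \<inter> S))"
    by (intro sum.cong refl arg_cong[where f = card]) (auto simp: cross_nbrs_def)
  also have "\<dots> = arcs E ({..<n} - S) S" using arcs_sum[OF _ E] by simp
  finally show ?thesis using cut_val_arcs[OF E] arcs_commute[of E S] by simp
qed

lemma cut_val_complement:
  assumes E: "E \<in> graphs n" and S: "S \<subseteq> {..<n}"
  shows "cut_val E ({..<n} - S) = cut_val E S"
proof -
  have "{..<n} - ({..<n} - S) = S" using S by auto
  then show ?thesis using cut_val_arcs[OF E] arcs_commute[of E S] by simp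
qed

lemma is_global_min_cut_complement:
  assumes E: "E \<in> graphs n" and S: "is_global_min_cut n E S"
  shows "is_global_min_cut n E ({..<n} - S)"
proof (rule is_global_min_cut_le[OF S])
  have "S \<noteq> {}" "S \<subset> {..<n}" using S by (auto simp: is_global_min_cut_def)
  then show "{..<n} - S \<noteq> {}" "{..<n} - S \<subset> {..<n}" "cut_val E ({..<n} - S) \<le> cut_val E S"
    using cut_val_complement[OF E] by auto
qed

lemma min_degree_le:
  assumes "E \<in> graphs n" "v < n"
  shows "min_degree n E \<le> card (nbrs E v)"
  unfolding min_degree_def cut_val_singleton[OF assms(1)] using assms(2) by (intro Min_le) auto

text \<open>Compare \<open>S\<close> with \<open>S - {v}\<close>, which is nonempty because a
  singleton has value at least the minimum degree. Moving \<open>v\<close> out trades its crossing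
  edges for its edges inside \<open>S\<close>, and by minimality of \<open>S\<close> this cannot
  pay.\<close>

lemma card_cross_nbrs_le_aux:
  assumes E: "E \<in> graphs n" and S: "is_global_min_cut n E S" "cut_val E S < min_degree n E"
    and v: "v \<in> S"
  shows "2 * card (cross_nbrs E S v) \<le> card (nbrs E v)"
proof -
  define S' where "S' = S - {v}"
  define B where "B = {..<n} - S"
  have Sn: "S \<subset> {..<n}" using S by (auto simp: is_global_min_cut_def)
  have "S' \<noteq> {}"
  proof
    assume "S' = {}"
    then have "S = {v}" using v by (auto simp: S'_def)
    then show False using S(2) min_degree_le[OF E, of v] Sn cut_val_singleton[OF E, of v] by auto
  qed
  moreover have "S' \<subset> {..<n}" using Sn unfolding S'_def by (rule subset_psubset_trans[rotated]) auto
  ultimately have "cut_val E S \<le> cut_val E S'"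
    using S(1) by (simp add: is_global_min_cut_def)
  moreover have "S = {v} \<union> S'" "{..<n} - S' = {v} \<union> B" "{v} \<inter> S' = {}" "{v} \<inter> B = {}"
    using v Sn by (auto simp: S'_def B_def)
  then have "cut_val E S = arcs E {v} B + arcs E S' B" "cut_val E S' = arcs E S' {v} + arcs E S' B"
    using cut_val_arcs[OF E, of S] cut_val_arcs[OF E, of S']
      arcs_Un_left[OF E, of "{v}" S' B] arcs_Un_right[OF E, of "{v}" B S'] by (simp_all add: B_def)
  ultimately have le: "card (nbrs E v \<inter> B) \<le> card (nbrs E v \<inter> S')"
    using arcs_commute[of E S' "{v}"] by (simp add: arcs_singleton)
  have fin: "finite (nbrs E v)" using nbrs_subset[OF E] finite_subset by blast
  have nb: "nbrs E v = (nbrs E v \<inter> B) \<union> (nbrs E v \<inter> S')" "nbrs E v \<inter> B = cross_nbrs E S v"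
    using nbrs_subset[OF E, of v] v by (auto simp: B_def S'_def cross_nbrs_def)
  have "card (nbrs E v) = card (nbrs E v \<inter> B) + card (nbrs E v \<inter> S')"
    by (subst nb(1), rule card_Un_disjoint) (use fin in \<open>auto simp: B_def S'_def\<close>)
  then show ?thesis using le nb(2) by simp
qed

text \<open>A vertex outside \<open>S\<close> lies in the complement, which is again a minimum cut
  with the same crossing neighbours.\<close>

lemma card_cross_nbrs_le:
  assumes E: "E \<in> graphs n" and S: "is_global_min_cut n E S" "cut_val E S < min_degree n E"
    and v: "v < n"
  shows "2 * card (cross_nbrs E S v) \<le> card (nbrs E v)"
proof (cases "v \<in> S")
  case True
  then show ?thesis using card_cross_nbrs_le_aux[OF E S] by blast
next
  case False
  have Sn: "S \<subseteq> {..<n}" using S by (auto simp: is_global_min_cut_def)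
  have "cross_nbrs E ({..<n} - S) v = cross_nbrs E S v"
    using nbrs_subset[OF E, of v] v by (auto simp: cross_nbrs_def)
  then show ?thesis
    using card_cross_nbrs_le_aux[OF E is_global_min_cut_complement[OF E S(1)], of v] False v S(2)
      cut_val_complement[OF E Sn] by auto
qed

section \<open>Success probability\<close>

lemma star_label_spec:
  assumes "v \<notin> R" "finite R" "nbrs E v \<inter> R \<noteq> {}"
  shows "star_label E R u v \<in> nbrs E v \<inter> R"
    "card (nbrs E v \<inter> R \<inter> {..<star_label E R u v}) = u mod card (nbrs E v \<inter> R)"
proof -
  define A where "A = nbrs E v \<inter> R"
  have A: "finite A" "A \<noteq> {}" using assms by (auto simp: A_def)
  have inj: "inj_on (\<lambda>w. card (A \<inter> {..<w})) A" by (auto simp: inj_on_def intro: rank_inj)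
  \<comment> \<open>An injection of \<open>A\<close> into \<open>{..<card A}\<close> is onto, so
    every residue is the rank of some neighbouring centre.\<close>
  have "(\<lambda>w. card (A \<inter> {..<w})) ` A = {..<card A}"
  proof (rule card_subset_eq)
    show "(\<lambda>w. card (A \<inter> {..<w})) ` A \<subseteq> {..<card A}"
      using A by (auto intro!: psubset_card_mono)
    show "card ((\<lambda>w. card (A \<inter> {..<w})) ` A) = card {..<card A}" using card_image[OF inj] by simp
  qed auto
  moreover have "u mod card A \<in> {..<card A}" using A by (auto simp: card_gt_0_iff)
  ultimately have "u mod card A \<in> (\<lambda>w. card (A \<inter> {..<w})) ` A" by simp
  then obtain w where w: "w \<in> A" "card (A \<inter> {..<w}) = u mod card A"
    by (metis (no_types, lifting) imageE)
  have "star_label E R u v = w"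
    by (rule star_label_eqI) (use w assms in \<open>auto simp: A_def\<close>)
  then show "star_label E R u v \<in> nbrs E v \<inter> R"
    "card (nbrs E v \<inter> R \<inter> {..<star_label E R u v}) = u mod card (nbrs E v \<inter> R)"
    using w by (simp_all add: A_def)
qed

lemma card_mod_in:
  fixes m N :: nat
  assumes "m dvd N" "0 < m" "I \<subseteq> {..<m}"
  shows "card {u. u < N \<and> u mod m \<in> I} = N div m * card I"
proof -
  obtain k where N: "N = m * k" using assms(1) ..
  have "bij_betw (\<lambda>(q, i). q * m + i) ({..<k} \<times> I) {u. u < N \<and> u mod m \<in> I}"
  proof (rule bij_betwI[where g = "\<lambda>u. (u div m, u mod m)"])
    show "(\<lambda>(q, i). q * m + i) \<in> {..<k} \<times> I \<rightarrow> {u. u < N \<and> u mod m \<in> I}"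
    proof safe
      fix q i assume qi: "q < k" "i \<in> I"
      then have i: "i < m" using assms(3) by auto
      have "q * m + i < Suc q * m" using i by simp
      also have "\<dots> \<le> k * m" using qi by (intro mult_le_mono1) auto
      finally show "q * m + i < N" by (simp add: N mult.commute)
      show "(q * m + i) mod m \<in> I" using i qi by simp
    qed
    show "(\<lambda>u. (u div m, u mod m)) \<in> {u. u < N \<and> u mod m \<in> I} \<rightarrow> {..<k} \<times> I"
      using assms(2) by (auto simp: N less_mult_imp_div_less mult.commute)
  qed (use assms in auto)
  from bij_betw_same_card[OF this] show ?thesis
    using assms(2) by (simp add: N card_cartesian_product)
qed

text \<open>The choice of \<open>u\<close> below \<open>n!\<close> makes \<open>u mod m\<close> exactly uniform for all \<open>m \<le> n\<close> simultaneously.\<close>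

lemma prob_star_label_same_side:
  assumes E: "E \<in> graphs n" and R: "R \<subseteq> {..<n}" "v \<notin> R" "nbrs E v \<inter> R \<noteq> {}"
  shows "measure_pmf.prob (pmf_of_set {..<fact n}) {u. star_label E R u v \<in> S \<longleftrightarrow> v \<in> S}
    \<ge> 1 - card (cross_nbrs E S v \<inter> R) / card (nbrs E v \<inter> R)"
proof -
  define A where "A = nbrs E v \<inter> R"
  define m where "m = card A"
  define r where "r = (\<lambda>w. card (A \<inter> {..<w}))"
  define I where "I = r ` (cross_nbrs E S v \<inter> R)"
  have finR: "finite R" using R finite_subset by blast
  have A: "finite A" "A \<noteq> {}" "A \<subseteq> {..<n}" using R finR by (auto simp: A_def)
  have m: "0 < m" "m \<le> n" using A card_mono[OF _ A(3)] by (auto simp: m_def card_gt_0_iff)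
  have CA: "cross_nbrs E S v \<inter> R \<subseteq> A" by (auto simp: A_def cross_nbrs_def)
  have Im: "I \<subseteq> {..<m}" using CA A(1) by (auto simp: I_def r_def m_def intro!: psubset_card_mono)
  have cI: "card I \<le> card (cross_nbrs E S v \<inter> R)"
    unfolding I_def by (rule card_image_le) (use finR in auto)
  let ?B = "{u. \<not> (star_label E R u v \<in> S \<longleftrightarrow> v \<in> S)}"
  let ?U = "pmf_of_set {..<fact n :: nat}"
  have ne: "{..<fact n :: nat} \<noteq> {}" by (auto simp: lessThan_empty_iff)
  \<comment> \<open>A wrong merge goes to a crossing centre, and the residue of \<open>u\<close> is
    then its rank.\<close>
  have sub: "?B \<subseteq> {u. u mod m \<in> I}"
  proof
    fix u assume u: "u \<in> ?B"
    note spec = star_label_spec[OF R(2) finR R(3), of u]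
    have "star_label E R u v \<in> cross_nbrs E S v \<inter> R" using spec(1) u by (auto simp: cross_nbrs_def)
    moreover have "u mod m = r (star_label E R u v)" using spec(2) by (simp add: r_def A_def m_def)
    ultimately show "u \<in> {u. u mod m \<in> I}" by (auto simp: I_def)
  qed
  have "measure_pmf.prob ?U ?B \<le> measure_pmf.prob ?U {u. u mod m \<in> I}"
    by (rule measure_pmf.finite_measure_mono[OF sub]) simp
  also have "\<dots> = real (card {u. u < fact n \<and> u mod m \<in> I}) / fact n"
    using ne by (subst measure_pmf_of_set) (auto simp: Int_def)
  also have "\<dots> = real (fact n div m * card I) / fact n"
    by (subst card_mod_in) (use m Im in \<open>auto intro: dvd_fact\<close>)
  also have "\<dots> = card I / m"
  proof -
    have "m dvd fact n" using m by (auto intro: dvd_fact)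
    then have "real (fact n div m) = real (fact n) / real m" by (rule real_of_nat_div)
    then show ?thesis by simp
  qed
  also have "\<dots> \<le> card (cross_nbrs E S v \<inter> R) / m"
    using cI by (intro divide_right_mono) auto
  finally have "measure_pmf.prob ?U ?B \<le> card (cross_nbrs E S v \<inter> R) / card (nbrs E v \<inter> R)"
    by (simp add: m_def A_def)
  moreover have "measure_pmf.prob ?U {u. star_label E R u v \<in> S \<longleftrightarrow> v \<in> S} = 1 - measure_pmf.prob ?U ?B"
    using measure_pmf.prob_compl[of ?B ?U] by (auto simp: Compl_eq_Diff_UNIV[symmetric] Collect_neg_eq[symmetric])
  ultimately show ?thesis by linarith
qed

text \<open>Fubini: integrate over \<open>x\<close> the conditional probability of \<open>X\<close>,
  which is at least \<open>b\<close> on \<open>A\<close>.\<close>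

lemma prob_pair_pmf_ge:
  assumes "a \<le> measure_pmf.prob p A" "0 \<le> b" "\<And>x. x \<in> A \<Longrightarrow> b \<le> measure_pmf.prob q {y. (x, y) \<in> X}"
  shows "a * b \<le> measure_pmf.prob (pair_pmf p q) X"
proof -
  have "ennreal (b * measure_pmf.prob p A) = ennreal b * emeasure (measure_pmf p) A"
    using assms(2) by (simp add: measure_pmf.emeasure_eq_measure ennreal_mult)
  also have "\<dots> = (\<integral>\<^sup>+x. ennreal b * indicator A x \<partial>measure_pmf p)"
    by (simp add: nn_integral_cmult)
  also have "\<dots> \<le> (\<integral>\<^sup>+x. emeasure (measure_pmf q) {y. (x, y) \<in> X} \<partial>measure_pmf p)"
    using assms(3) by (intro nn_integral_mono)
      (auto simp: measure_pmf.emeasure_eq_measure indicator_def ennreal_leI)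
  also have "\<dots> = (\<integral>\<^sup>+x. \<integral>\<^sup>+y. indicator X (x, y) \<partial>measure_pmf q \<partial>measure_pmf p)"
  proof (rule nn_integral_cong)
    fix x
    have "(\<lambda>y. indicator X (x, y) :: ennreal) = indicator {y. (x, y) \<in> X}"
      by (auto simp: indicator_def)
    then show "emeasure (measure_pmf q) {y. (x, y) \<in> X} = (\<integral>\<^sup>+y. indicator X (x, y) \<partial>measure_pmf q)"
      by simp
  qed
  also have "\<dots> = emeasure (measure_pmf (pair_pmf p q)) X"
    by (simp add: nn_integral_pair_pmf'[symmetric])
  finally have "b * measure_pmf.prob p A \<le> measure_pmf.prob (pair_pmf p q) X"
    by (simp add: measure_pmf.emeasure_eq_measure)
  moreover have "a * b \<le> b * measure_pmf.prob p A"
    using mult_right_mono[OF assms(1,2)] by (simp add: mult.commute)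
  ultimately show ?thesis by linarith
qed

text \<open>The exponent 4 is tied to the range up to 3/4: (1 - x)(1 + 4x) = 1 + 4x(3/4 - x) is at
  least 1 there. In this form the success probabilities of single merges can be multiplied over all
  vertices.\<close>

lemma one_minus_ge_exp:
  fixes x :: real
  assumes "0 \<le> x" "x \<le> 3 / 4"
  shows "exp (- 4 * x) \<le> 1 - x"
proof -
  have "1 \<le> (1 - x) * (1 + 4 * x)" using assms mult_nonneg_nonneg[of x "3 / 4 - x"]
    by (simp add: algebra_simps)
  also have "\<dots> \<le> (1 - x) * exp (4 * x)"
    using assms exp_ge_add_one_self[of "4 * x"] by (intro mult_left_mono) auto
  finally show ?thesis by (simp add: exp_minus field_simps)
qed

section \<open>Random ranks and good centres\<close>

definition rank_pmf :: "nat \<Rightarrow> (nat \<Rightarrow> nat) pmf" where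
  "rank_pmf n = Pi_pmf {..<n} 0 (\<lambda>_. pmf_of_set {..<n})"

lemma set_rank_pmf:
  assumes "0 < n"
  shows "finite (set_pmf (rank_pmf n))" "t \<in> set_pmf (rank_pmf n) \<Longrightarrow> v < n \<Longrightarrow> t v < n"
proof -
  have "{..<n} \<noteq> {}" using assms by (auto simp: lessThan_empty_iff)
  then have s: "set_pmf (rank_pmf n) = PiE_dflt {..<n} 0 (\<lambda>_. {..<n})"
    unfolding rank_pmf_def by (subst set_Pi_pmf) (auto simp: o_def)
  show "finite (set_pmf (rank_pmf n))" unfolding s by (intro finite_PiE_dflt) auto
  show "t \<in> set_pmf (rank_pmf n) \<Longrightarrow> v < n \<Longrightarrow> t v < n" unfolding s by (auto simp: PiE_dflt_def)
qed

lemma expectation_below: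
  assumes "0 < n" "j \<le> n"
  shows "measure_pmf.expectation (pmf_of_set {..<n}) (\<lambda>y. if y < j then c else e :: real)
    = e + real j / n * (c - e)"
proof -
  have ne: "{..<n} \<noteq> {}" using assms by (auto simp: lessThan_empty_iff)
  have "(\<Sum>y<n. if y < j then c else e) = (\<Sum>y\<in>{..<n} \<inter> {y. y < j}. c) + (\<Sum>y\<in>{..<n} \<inter> - {y. y < j}. e)"
    by (rule sum.If_cases) simp
  also have "{..<n} \<inter> {y. y < j} = {..<j}" using assms by auto
  also have "{..<n} \<inter> - {y. y < j} = {j..<n}" by auto
  finally have "(\<Sum>y<n. if y < j then c else e) = j * c + (real n - j) * e" using assms by simp
  then show ?thesis using ne assms
    by (simp add: integral_pmf_of_set field_simps)
qed

text \<open>The exponential moment method. Independence turns the expectation into a product, and a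
  factor \<open>a w\<close> present with probability p = \<open>j / n\<close> has mean 1 + p
  (\<open>a w\<close> - 1) \<le> exp (p (\<open>a w\<close> - 1)).\<close>

lemma expectation_prod_centres:
  assumes n: "0 < n" "j \<le> n" and U: "U \<subseteq> {..<n}" and a: "\<And>w. 0 \<le> a w"
  shows "measure_pmf.expectation (rank_pmf n) (\<lambda>t. \<Prod>w\<in>U \<inter> centres n j t. a w)
    \<le> exp (real j / n * (\<Sum>w\<in>U. a w - 1))"
proof -
  define f where "f = (\<lambda>w y. if w \<in> U \<and> y < j then a w else 1)"
  have "{..<n} \<noteq> {}" using n by (auto simp: lessThan_empty_iff)
  then have fin: "finite (set_pmf (pmf_of_set {..<n}))" by simp
  have "(\<Prod>w\<in>U \<inter> centres n j t. a w) = (\<Prod>w<n. f w (t w))" for t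
    by (rule prod.mono_neutral_cong_left) (auto simp: f_def centres_def)
  then have "measure_pmf.expectation (rank_pmf n) (\<lambda>t. \<Prod>w\<in>U \<inter> centres n j t. a w)
      = measure_pmf.expectation (rank_pmf n) (\<lambda>t. \<Prod>w<n. f w (t w))" by simp
  also have "\<dots> = (\<Prod>w<n. measure_pmf.expectation (pmf_of_set {..<n}) (f w))"
    unfolding rank_pmf_def
    by (rule expectation_prod_Pi_pmf) (use fin a in \<open>auto simp: f_def intro: integrable_measure_pmf_finite\<close>)
  also have "\<dots> \<le> (\<Prod>w<n. exp (if w \<in> U then real j / n * (a w - 1) else 0))"
  proof (rule prod_mono, rule conjI)
    fix w
    show "0 \<le> measure_pmf.expectation (pmf_of_set {..<n}) (f w)"
      by (rule integral_nonneg_AE) (use a in \<open>auto simp: f_def\<close>)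
    show "measure_pmf.expectation (pmf_of_set {..<n}) (f w)
        \<le> exp (if w \<in> U then real j / n * (a w - 1) else 0)"
    proof (cases "w \<in> U")
      case True
      then have "f w = (\<lambda>y. if y < j then a w else 1)" by (auto simp: f_def)
      then show ?thesis using True expectation_below[OF n, of "a w" 1]
          exp_ge_add_one_self[of "real j / n * (a w - 1)"] by simp
    next
      case False
      then have "f w = (\<lambda>_. 1)" by (auto simp: f_def)
      then show ?thesis using False by simp
    qed
  qed
  also have "\<dots> = exp (\<Sum>w<n. if w \<in> U then real j / n * (a w - 1) else 0)"
    by (simp add: exp_sum)
  also have "(\<Sum>w<n. if w \<in> U then real j / n * (a w - 1) else 0) = (\<Sum>w\<in>U. real j / n * (a w - 1))"
    by (rule sum.mono_neutral_cong_right) (use U in auto)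
  also have "\<dots> = real j / n * (\<Sum>w\<in>U. a w - 1)" by (simp add: sum_distrib_left)
  finally show ?thesis .
qed

lemma expectation_card_centres:
  assumes n: "0 < n" "j \<le> n" and U: "U \<subseteq> {..<n}"
  shows "measure_pmf.expectation (rank_pmf n) (\<lambda>t. real (card (U \<inter> centres n j t))) = real j / n * card U"
proof -
  have finU: "finite U" using U finite_subset by blast
  have int: "integrable (measure_pmf (rank_pmf n)) g" for g :: "_ \<Rightarrow> real"
    using set_rank_pmf[OF n(1)] by (intro integrable_measure_pmf_finite)
  have "real (card (U \<inter> centres n j t)) = (\<Sum>w\<in>U. if t w < j then 1 else 0)" for t
  proof -
    have "U \<inter> centres n j t = {w \<in> U. t w < j}" using U by (auto simp: centres_def)
    then show ?thesis using finU by (simp add: sum.If_cases Int_def)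
  qed
  then have "measure_pmf.expectation (rank_pmf n) (\<lambda>t. real (card (U \<inter> centres n j t)))
      = (\<Sum>w\<in>U. measure_pmf.expectation (rank_pmf n) (\<lambda>t. if t w < j then 1 else 0))"
    using int by simp
  also have "\<dots> = (\<Sum>w\<in>U. real j / n)"
  proof (rule sum.cong[OF refl])
    fix w assume w: "w \<in> U"
    have "measure_pmf.expectation (rank_pmf n) (\<lambda>t. if t w < j then 1 else 0 :: real)
       = measure_pmf.expectation (map_pmf (\<lambda>t. t w) (rank_pmf n)) (\<lambda>y. if y < j then 1 else 0)"
      by simp
    also have "map_pmf (\<lambda>t. t w) (rank_pmf n) = pmf_of_set {..<n}"
      unfolding rank_pmf_def using w U by (subst Pi_pmf_component) auto
    finally show "measure_pmf.expectation (rank_pmf n) (\<lambda>t. if t w < j then 1 else 0 :: real) = real j / n"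
      using expectation_below[OF n, of 1 0] by simp
  qed
  finally show ?thesis by simp
qed

text \<open>The first condition keeps the fraction of wrong centres around each vertex below 3/4.
  The second and the last together bound the sum of these fractions. Here 16 is eight times the
  factor 2 from the bound \<open>2 * d\<close> on crossing arcs, just as \<open>8 * j\<close> is
  eight times the mean number of centres. Abstract \<open>N\<close> and \<open>C\<close> separate
  the sampling from the graph.\<close>

definition good_centres ::
  "nat \<Rightarrow> nat \<Rightarrow> (nat \<Rightarrow> nat set) \<Rightarrow> (nat \<Rightarrow> nat set) \<Rightarrow> nat set \<Rightarrow> bool" where
  "good_centres n j N C R \<longleftrightarrow>
    (\<forall>v<n. card (C v \<inter> R) < 3 * card ((N v - C v) \<inter> R) \<and>
       real j / n * card (N v) / 4 \<le> card (N v \<inter> R)) \<and>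
    card R \<le> 8 * j \<and>
    (\<Sum>v<n. real (card (C v \<inter> R)) / card (N v)) \<le> 16 * (real j / n)"

text \<open>
  All four kinds of failure are bounded at once by the expectation of a sum of nonnegative terms, one
  of which is at least \<open>1\<close> whenever the centres are bad. \<open>M1\<close> detects \<open>cr \<ge> 3 * sm\<close> since
  \<open>(6/5)\<^sup>3 * (125/216) = 1\<close>.
\<close>

lemma prob_good_centres:
  assumes n: "8 \<le> n" "0 < j" "j \<le> n"
    and NC: "\<And>v. N v \<subseteq> {..<n}" "\<And>v. C v \<subseteq> N v"
    and half: "\<And>v. v < n \<Longrightarrow> 2 * card (C v) \<le> card (N v)"
    and d: "0 < d" "\<And>v. v < n \<Longrightarrow> d \<le> card (N v)" "(\<Sum>v<n. card (C v)) \<le> 2 * d"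
    and pd: "20 * ln n \<le> real j / n * d"
  shows "1 / 2 \<le> measure_pmf.prob (rank_pmf n) {t. good_centres n j N C (centres n j t)}"
proof -
  define p where "p = real j / n"
  have p: "0 < p" using n by (simp add: p_def)
  have n0: "0 < n" using n by simp
  define R where "R = centres n j"
  have Rn: "R t \<subseteq> {..<n}" for t by (auto simp: R_def centres_def)
  have fin: "finite (N v)" "finite (C v)" "finite (R t)" for v t
    using NC Rn finite_subset[OF _ finite_lessThan[of n]] by blast+
  have Cn: "C v \<subseteq> {..<n}" for v using NC by blast
  define a where "a = (\<lambda>v w. if w \<in> C v then 6 / 5 else 125 / 216 :: real)"
  define M1 where "M1 = (\<lambda>v t. \<Prod>w\<in>N v \<inter> R t. a v w)"
  \<comment> \<open>Lower tail: the prefactor lifts \<open>M2 v\<close> above 1 once fewer than a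
    quarter of the expected centres are seen around \<open>v\<close>.\<close>
  define M2 where "M2 = (\<lambda>v t. exp (p * card (N v) / 4) * (\<Prod>w\<in>N v \<inter> R t. exp (- 1)))"
  define Y where "Y = (\<lambda>t. \<Sum>v<n. real (card (C v \<inter> R t)) / card (N v))"
  define Z where "Z = (\<lambda>t. (\<Sum>v<n. M1 v t + M2 v t) + real (card ({..<n} \<inter> R t)) / (8 * j) + Y t / (16 * p))"
  have int: "integrable (measure_pmf (rank_pmf n)) g" for g :: "_ \<Rightarrow> real"
    using set_rank_pmf[OF n0] by (intro integrable_measure_pmf_finite)
  let ?E = "measure_pmf.expectation (rank_pmf n)"
  \<comment> \<open>The constant 20 of \<open>num_centres\<close> enters here: a tenth of 20 ln n is
    2 ln n, enough for a union bound over all vertices.\<close>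
  have small: "exp (- (p * card (N v) / 10)) \<le> 1 / (real n)\<^sup>2" if "v < n" for v
  proof -
    have "20 * ln n \<le> p * card (N v)"
      using pd mult_left_mono[of "real d" "card (N v)" p] p d(2)[OF that] by (simp add: p_def)
    then have "exp (- (p * card (N v) / 10)) \<le> exp (- (ln n + ln n))" by simp
    also have "\<dots> = 1 / (real n)\<^sup>2" using n0 by (simp only: exp_minus exp_add) (simp add: power2_eq_square field_simps)
    finally show ?thesis .
  qed
  have E1: "?E (M1 v) \<le> 1 / (real n)\<^sup>2" if v: "v < n" for v
  proof -
    have "?E (M1 v) \<le> exp (p * (\<Sum>w\<in>N v. a v w - 1))"
      unfolding M1_def R_def p_def by (rule expectation_prod_centres) (use n NC in \<open>auto simp: a_def\<close>)
    also have "(\<Sum>w\<in>N v. a v w - 1) = (\<Sum>w\<in>C v. a v w - 1) + (\<Sum>w\<in>N v - C v. a v w - 1)"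
      using sum.subset_diff[OF NC(2) fin(1), of "\<lambda>w. a v w - 1" v] by (simp only: add.commute)
    also have "(\<Sum>w\<in>C v. a v w - 1) = card (C v) / 5" by (simp add: a_def)
    also have "(\<Sum>w\<in>N v - C v. a v w - 1) = (\<Sum>w\<in>N v - C v. - 91 / 216)"
      by (rule sum.cong) (auto simp: a_def)
    also have "\<dots> = - 91 / 216 * (real (card (N v)) - card (C v))"
      using fin NC(2) card_mono[OF fin(1) NC(2)] by (simp add: card_Diff_subset)
    also have "exp (p * (card (C v) / 5 + - 91 / 216 * (real (card (N v)) - card (C v))))
        \<le> exp (- (p * card (N v) / 10))"
    proof -
      \<comment> \<open>The worst case is half of the neighbours crossing, where the factor is 1/10
        - 91/432 < -1/10.\<close>
      have "card (C v) / 5 + - 91 / 216 * (real (card (N v)) - card (C v)) \<le> - (card (N v) / 10)"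
      proof -
        have "real (2 * card (C v)) \<le> real (card (N v))" using half[OF v] by (simp only: of_nat_le_iff)
        then show ?thesis by (simp add: field_simps)
      qed
      from mult_left_mono[OF this, of p] p show ?thesis by simp
    qed
    also note small[OF v]
    finally show ?thesis .
  qed
  have E2: "?E (M2 v) \<le> 1 / (real n)\<^sup>2" if v: "v < n" for v
  proof -
    have "?E (\<lambda>t. \<Prod>w\<in>N v \<inter> R t. exp (- 1)) \<le> exp (p * (\<Sum>w\<in>N v. exp (- 1) - 1))"
      unfolding R_def p_def by (rule expectation_prod_centres) (use n NC in auto)
    then have "?E (M2 v) \<le> exp (p * card (N v) / 4) * exp (p * (\<Sum>w\<in>N v. exp (- 1) - 1))"
      unfolding M2_def by simp
    also have "\<dots> = exp (p * card (N v) / 4 + p * (card (N v) * (exp (- 1) - 1)))"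
      by (simp add: exp_add)
    also have "\<dots> \<le> exp (- (p * card (N v) / 10))"
    proof -
      have "exp (- 1 :: real) \<le> 1 / 2"
        using exp_ge_add_one_self[of "1::real"] by (simp add: exp_minus field_simps)
      then have "(p * card (N v)) * (exp (- 1) - 1) \<le> (p * card (N v)) * (- 1 / 2)"
        using p by (intro mult_left_mono) auto
      moreover have "0 \<le> p * card (N v)" using p by simp
      ultimately have "p * card (N v) / 4 + p * (card (N v) * (exp (- 1) - 1)) \<le> - (p * card (N v) / 10)"
        by (simp only: mult.assoc[symmetric])
      then show ?thesis by simp
    qed
    also note small[OF v]
    finally show ?thesis .
  qed
  have EY: "?E Y \<le> 2 * p"
  proof -
    have "?E Y = (\<Sum>v<n. ?E (\<lambda>t. real (card (C v \<inter> R t)) / card (N v)))"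
      unfolding Y_def by (intro Bochner_Integration.integral_sum int)
    also have "\<dots> = (\<Sum>v<n. p * card (C v) / card (N v))"
      using expectation_card_centres[OF n0 n(3) Cn] by (simp add: R_def p_def)
    also have "\<dots> \<le> (\<Sum>v<n. p * card (C v) / d)"
      using d p by (intro sum_mono divide_left_mono mult_nonneg_nonneg mult_pos_pos) (auto intro: less_le_trans)
    also have "\<dots> = p * real (\<Sum>v<n. card (C v)) / d"
      by (simp add: sum_divide_distrib sum_distrib_left)
    also have "\<dots> \<le> p * real (2 * d) / d"
      using d p by (intro divide_right_mono mult_left_mono) (auto simp only: of_nat_le_iff)
    finally show ?thesis using d by simp
  qed
  \<comment> \<open>The total is at most 1/2: \<open>2 / n\<close> \<le> 1/4 from the moment terms,
    and 1/8 each from the number of centres and from \<open>Y\<close>.\<close>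
  have "?E Z = (\<Sum>v<n. ?E (M1 v) + ?E (M2 v)) + ?E (\<lambda>t. real (card ({..<n} \<inter> R t))) / (8 * j) + ?E Y / (16 * p)"
    unfolding Z_def using int by simp
  also have "?E (\<lambda>t. real (card ({..<n} \<inter> R t))) = j"
    using expectation_card_centres[OF n0 n(3), of "{..<n}"] n0 by (simp add: R_def)
  also have "(\<Sum>v<n. ?E (M1 v) + ?E (M2 v)) \<le> (\<Sum>v<n. 1 / (real n)\<^sup>2 + 1 / (real n)\<^sup>2)"
    by (intro sum_mono add_mono E1 E2) auto
  also have "\<dots> = 2 / n" using n0 by (simp add: power2_eq_square)
  also have "2 / real n \<le> 1 / 4" using n by simp
  also have "?E Y / (16 * p) \<le> 2 * p / (16 * p)" using p EY by (intro divide_right_mono) auto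
  finally have EZ: "?E Z \<le> 1 / 2" using n p by simp
  have nonneg: "0 \<le> M1 v t" "0 \<le> M2 v t" "0 \<le> Y t" for v t
    by (auto simp: M1_def M2_def Y_def a_def intro!: prod_nonneg sum_nonneg)
  have Z1: "1 \<le> Z t" if bad: "\<not> good_centres n j N C (R t)" for t
  proof -
    have S0: "0 \<le> (\<Sum>v<n. M1 v t + M2 v t)" using nonneg by (intro sum_nonneg add_nonneg_nonneg)
    have S1: "M1 v t + M2 v t \<le> (\<Sum>v<n. M1 v t + M2 v t)" if "v < n" for v
      by (rule member_le_sum) (use that nonneg in auto)
    have nn: "0 \<le> real (card ({..<n} \<inter> R t)) / (8 * j)" "0 \<le> Y t / (16 * p)"
      using nonneg p by auto
    consider (1) v where "v < n" "card (C v \<inter> R t) \<ge> 3 * card ((N v - C v) \<inter> R t)"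
      | (2) v where "v < n" "real j / n * card (N v) / 4 > card (N v \<inter> R t)"
      | (3) "card (R t) > 8 * j"
      | (4) "Y t > 16 * p"
      using bad unfolding good_centres_def Y_def p_def by force
    then show ?thesis
    proof cases
      case 1
      have "M1 v t = (\<Prod>w\<in>C v \<inter> R t. a v w) * (\<Prod>w\<in>(N v - C v) \<inter> R t. a v w)"
      proof -
        have "N v \<inter> R t = (C v \<inter> R t) \<union> ((N v - C v) \<inter> R t)" using NC by auto
        then show ?thesis unfolding M1_def using fin
          by (simp only:, intro prod.union_disjoint) auto
      qed
      also have "(\<Prod>w\<in>C v \<inter> R t. a v w) = (6 / 5) ^ card (C v \<inter> R t)"
        by (simp add: a_def)
      also have "(\<Prod>w\<in>(N v - C v) \<inter> R t. a v w) = (\<Prod>w\<in>(N v - C v) \<inter> R t. 125 / 216)"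
        by (rule prod.cong) (auto simp: a_def)
      also have "\<dots> = (125 / 216) ^ card ((N v - C v) \<inter> R t)" by simp
      finally have M: "M1 v t = (6 / 5) ^ card (C v \<inter> R t) * (125 / 216) ^ card ((N v - C v) \<inter> R t)" .
      have "(1::real) = (6 / 5) ^ (3 * card ((N v - C v) \<inter> R t)) * (125 / 216) ^ card ((N v - C v) \<inter> R t)"
        unfolding power_mult power_mult_distrib[symmetric] by (simp add: power3_eq_cube)
      also have "\<dots> \<le> M1 v t" unfolding M using 1
        by (intro mult_right_mono power_increasing) auto
      finally show ?thesis using S1[OF 1(1)] nonneg(2)[of v t] nn unfolding Z_def by linarith
    next
      case 2
      have "M2 v t = exp (p * card (N v) / 4 - card (N v \<inter> R t))"
        unfolding M2_def by (simp add: mult_exp_exp exp_of_nat_mult[symmetric])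
      also have "\<dots> \<ge> 1" using 2 by (simp add: p_def)
      finally show ?thesis using S1[OF 2(1)] nonneg(1)[of v t] nn unfolding Z_def by linarith
    next
      case 3
      have "{..<n} \<inter> R t = R t" using Rn by blast
      then have "1 \<le> real (card ({..<n} \<inter> R t)) / (8 * j)" using 3 n by simp
      then show ?thesis using S0 nn unfolding Z_def by linarith
    next
      case 4
      then have "1 \<le> Y t / (16 * p)" using p by simp
      then show ?thesis using S0 nn unfolding Z_def by linarith
    qed
  qed
  have Z0: "0 \<le> Z t" for t
    unfolding Z_def using nonneg p by (intro add_nonneg_nonneg sum_nonneg divide_nonneg_nonneg) auto
  let ?B = "{t. \<not> good_centres n j N C (R t)}"
  have "measure_pmf.prob (rank_pmf n) ?B = ?E (indicator ?B)" by simp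
  also have "\<dots> \<le> ?E Z"
    by (intro integral_mono int) (use Z1 Z0 in \<open>auto simp: indicator_def\<close>)
  finally have "measure_pmf.prob (rank_pmf n) ?B \<le> 1 / 2" using EZ by linarith
  moreover have "measure_pmf.prob (rank_pmf n) {t. good_centres n j N C (R t)}
     = 1 - measure_pmf.prob (rank_pmf n) ?B"
    using measure_pmf.prob_compl[of ?B "rank_pmf n"]
    by (auto simp: Compl_eq_Diff_UNIV[symmetric] Collect_neg_eq[symmetric])
  ultimately show ?thesis by (simp add: R_def)
qed

section \<open>Random merges given good centres\<close>

definition choice_pmf :: "nat \<Rightarrow> (nat \<Rightarrow> nat) pmf" where
  "choice_pmf n = Pi_pmf {..<n} 0 (\<lambda>_. pmf_of_set {..<fact n})"

text \<open>Choices at different vertices are independent, and a vertex \<open>v\<close> goes wrong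
  with probability at most \<open>x v\<close>. By the conditions on \<open>R\<close>, each
  \<open>x v\<close> is at most 3/4 and their sum at most (4/p)(16 p) = 64, which gives the exponent
  4 * 64 = 256.\<close>

lemma prob_all_same_side:
  assumes E: "E \<in> graphs n" and R: "R \<subseteq> {..<n}" and j: "0 < j" "0 < n"
    and good: "good_centres n j (nbrs E) (cross_nbrs E S) R"
    and deg: "\<And>v. v < n \<Longrightarrow> 0 < card (nbrs E v)"
  shows "exp (- 256) \<le> measure_pmf.prob (choice_pmf n)
    {u. \<forall>v<n. star_label E R (u v) v \<in> S \<longleftrightarrow> v \<in> S}"
proof -
  define p where "p = real j / n"
  have p: "0 < p" using j by (simp add: p_def)
  define x where "x v = real (card (cross_nbrs E S v \<inter> R)) / card (nbrs E v \<inter> R)" for v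
  have finR: "finite R" using R finite_subset by blast
  have v: "x v \<le> 3 / 4" "x v \<le> 4 / p * (card (cross_nbrs E S v \<inter> R) / card (nbrs E v))"
    "nbrs E v \<inter> R \<noteq> {}" if "v < n" for v
  proof -
    let ?N = "nbrs E v" and ?C = "cross_nbrs E S v"
    have g: "card (?C \<inter> R) < 3 * card ((?N - ?C) \<inter> R)" "p * card ?N / 4 \<le> card (?N \<inter> R)"
      using good that by (auto simp: good_centres_def p_def)
    have "?N \<inter> R = (?C \<inter> R) \<union> ((?N - ?C) \<inter> R)" by (auto simp: cross_nbrs_def)
    then have c: "card (?N \<inter> R) = card (?C \<inter> R) + card ((?N - ?C) \<inter> R)"
      using finR by (simp only:, intro card_Un_disjoint) auto
    have "(?N - ?C) \<inter> R \<noteq> {}" using g(1) by auto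
    then show "?N \<inter> R \<noteq> {}" by auto
    then have pos: "0 < card (?N \<inter> R)" using finR by (auto simp: card_gt_0_iff)
    show "x v \<le> 3 / 4" using g(1) c pos by (simp add: x_def divide_le_eq)
    have pN: "0 < p * card ?N / 4" using p deg[OF that] by simp
    have "x v \<le> card (?C \<inter> R) / (p * card ?N / 4)"
      unfolding x_def using g(2) pN pos by (intro divide_left_mono) auto
    also have "\<dots> = 4 / p * (card (?C \<inter> R) / card ?N)" using p by (simp add: field_simps)
    finally show "x v \<le> 4 / p * (card (?C \<inter> R) / card ?N)" .
  qed
  have "(\<Sum>v<n. x v) \<le> (\<Sum>v<n. 4 / p * (card (cross_nbrs E S v \<inter> R) / card (nbrs E v)))"
    using v(2) by (intro sum_mono) auto
  also have "\<dots> = 4 / p * (\<Sum>v<n. card (cross_nbrs E S v \<inter> R) / card (nbrs E v))"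
    by (simp add: sum_distrib_left)
  also have "\<dots> \<le> 4 / p * (16 * p)"
    using good p by (intro mult_left_mono) (auto simp: good_centres_def p_def)
  also have "\<dots> = 64" using p by simp
  finally have "exp (- 256) \<le> exp (\<Sum>v<n. - 4 * x v)" by (simp add: sum_distrib_left[symmetric] sum_negf)
  also have "\<dots> = (\<Prod>v<n. exp (- 4 * x v))" by (simp add: exp_sum)
  also have "\<dots> \<le> (\<Prod>v<n. measure_pmf.prob (pmf_of_set {..<fact n})
      {u. star_label E R u v \<in> S \<longleftrightarrow> v \<in> S})"
  proof (rule prod_mono, rule conjI)
    fix v assume "v \<in> {..<n}"
    then have vn: "v < n" by simp
    have x0: "0 \<le> x v" by (simp add: x_def)
    show "exp (- 4 * x v) \<le> measure_pmf.prob (pmf_of_set {..<fact n})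
      {u. star_label E R u v \<in> S \<longleftrightarrow> v \<in> S}"
    proof (cases "v \<in> R")
      case True
      then have "{u. star_label E R u v \<in> S \<longleftrightarrow> v \<in> S} = UNIV" by (auto simp: star_label_def)
      then show ?thesis using x0 by simp
    next
      case False
      have "exp (- 4 * x v) \<le> 1 - x v" by (rule one_minus_ge_exp[OF x0 v(1)[OF vn]])
      then show ?thesis using prob_star_label_same_side[OF E R False v(3)[OF vn], of S]
        unfolding x_def by linarith
    qed
  qed simp
  also have "\<dots> = measure_pmf.prob (choice_pmf n)
      (Pi {..<n} (\<lambda>v. {u. star_label E R u v \<in> S \<longleftrightarrow> v \<in> S}))"
    unfolding choice_pmf_def by (rule measure_Pi_pmf_Pi[symmetric]) simp
  also have "Pi {..<n} (\<lambda>v. {u. star_label E R u v \<in> S \<longleftrightarrow> v \<in> S}) =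
      {u. \<forall>v<n. star_label E R (u v) v \<in> S \<longleftrightarrow> v \<in> S}" by auto
  finally show ?thesis .
qed

lemma exists_global_min_cut:
  assumes "2 \<le> n"
  shows "\<exists>S. is_global_min_cut n E S"
proof -
  define V where "V T \<longleftrightarrow> T \<noteq> {} \<and> T \<subset> {..<n}" for T
  have "V {0}" using singleton_psubset[of n 0] assms by (auto simp: V_def)
  from arg_min_nat_lemma[of V, OF this, of "cut_val E"]
  show ?thesis unfolding is_global_min_cut_def V_def by blast
qed

definition star_pmf :: "nat \<Rightarrow> ((nat \<Rightarrow> nat) \<times> (nat \<Rightarrow> nat)) pmf" where
  "star_pmf n = pair_pmf (rank_pmf n) (choice_pmf n)"

text \<open>If the minimum cut has value at least \<open>d\<close>, every seed succeeds. If the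
  threshold \<open>j\<close> reaches \<open>n\<close>, all vertices are centres and nothing is
  contracted. Otherwise the two random stages contribute 1/2 and \<open>exp (- 256)\<close>.\<close>

lemma prob_star_contraction_succeeds:
  assumes E: "E \<in> graphs n" and n: "8 \<le> n" and L: "ln n \<le> L"
  shows "exp (- 256) / 2 \<le> measure_pmf.prob (star_pmf n) {w. star_contraction_succeeds n L E w}"
proof -
  define d where "d = min_degree n E"
  define j where "j = num_centres n L d"
  have n0: "0 < n" using n by simp
  have j0: "0 < j" by (simp add: j_def num_centres_def)
  obtain S where S: "is_global_min_cut n E S" using exists_global_min_cut[of n E] n by auto
  have Sn: "S \<subseteq> {..<n}" using S by (auto simp: is_global_min_cut_def)
  define l where "l = (\<lambda>t u v. star_label E (centres n j t) (u v) v)"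
  have succ: "star_contraction_succeeds n L E (t, u)"
    if "cut_val E S < d \<Longrightarrow> sat n (l t u) S \<and> card (l t u ` {..<n}) \<le> 8 * j" for t u
    using that S unfolding star_contraction_succeeds_def Let_def d_def[symmetric] j_def[symmetric] l_def
    by auto
  have le1: "exp (- 256) \<le> (1 :: real)" by simp
  let ?X = "{w. star_contraction_succeeds n L E w}"
  consider (triv) "d \<le> cut_val E S" | (all) "n \<le> j" | (main) "cut_val E S < d" "j < n" by linarith
  then show ?thesis
  proof cases
    case triv
    then have "?X = UNIV" using succ by auto
    then have "measure_pmf.prob (star_pmf n) ?X = 1" by simp
    then show ?thesis using le1 by linarith
  next
    case all
    have "1 * 1 \<le> measure_pmf.prob (star_pmf n) ?X" unfolding star_pmf_def
    proof (rule prob_pair_pmf_ge)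
      show "1 \<le> measure_pmf.prob (rank_pmf n) (set_pmf (rank_pmf n))" 
        by (subst measure_pmf.prob_eq_1[THEN iffD2]) (auto simp: AE_measure_pmf_iff)
      fix t assume t: "t \<in> set_pmf (rank_pmf n)"
      have c: "centres n j t = {..<n}"
        using set_rank_pmf(2)[OF n0 t] all by (force simp: centres_def)
      have lid: "l t u v = v" if "v < n" for u v using that by (simp add: l_def c star_label_def)
      then have "sat n (l t u) S" "l t u ` {..<n} = {..<n}" for u by (auto simp: sat_def)
      then have "{u. (t, u) \<in> ?X} = UNIV" using succ all by auto
      then show "1 \<le> measure_pmf.prob (choice_pmf n) {u. (t, u) \<in> ?X}" by simp
    qed simp
    then show ?thesis using le1 by linarith
  next
    case main
    have d0: "0 < d" using main by simp
    have deg: "d \<le> card (nbrs E v)" if "v < n" for v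
      using min_degree_le[OF E that] by (simp add: d_def)
    \<comment> \<open>The summand \<open>1\<close> of \<open>num_centres\<close> absorbs the
      rounding of the division.\<close>
    have "20 * n * L < d * j"
      using d0 unfolding j_def num_centres_def by (simp add: dividend_less_times_div)
    then have "real (20 * n * L) \<le> real (d * j)" by (simp only: of_nat_le_iff less_imp_le)
    then have "20 * real L \<le> real j / n * d" using n0 by (simp add: field_simps)
    then have pd: "20 * ln n \<le> real j / n * d" using L by linarith
    have pg: "1 / 2 \<le> measure_pmf.prob (rank_pmf n)
        {t. good_centres n j (nbrs E) (cross_nbrs E S) (centres n j t)}"
    proof (rule prob_good_centres[OF n j0 _ _ _ _ d0 deg _ pd])
      show "2 * card (cross_nbrs E S v) \<le> card (nbrs E v)" if "v < n" for v
        using card_cross_nbrs_le[OF E S _ that] main by (simp add: d_def)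
      show "(\<Sum>v<n. card (cross_nbrs E S v)) \<le> 2 * d"
        using sum_card_cross_nbrs[OF E Sn] main by simp
    qed (use main nbrs_subset[OF E] in \<open>auto simp: cross_nbrs_def\<close>)
    have "1 / 2 * exp (- 256) \<le> measure_pmf.prob (star_pmf n) ?X" unfolding star_pmf_def
    proof (rule prob_pair_pmf_ge[OF pg])
      fix t assume "t \<in> {t. good_centres n j (nbrs E) (cross_nbrs E S) (centres n j t)}"
      then have good: "good_centres n j (nbrs E) (cross_nbrs E S) (centres n j t)" by simp
      have Rn: "centres n j t \<subseteq> {..<n}" by (auto simp: centres_def)
      then have finR: "finite (centres n j t)" using finite_subset by blast
      have "exp (- 256) \<le> measure_pmf.prob (choice_pmf n)
          {u. \<forall>v<n. star_label E (centres n j t) (u v) v \<in> S \<longleftrightarrow> v \<in> S}"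
        by (rule prob_all_same_side[OF E Rn j0 n0 good]) (use deg d0 in \<open>auto intro: less_le_trans\<close>)
      also have "\<dots> \<le> measure_pmf.prob (choice_pmf n) {u. (t, u) \<in> ?X}"
      proof (rule measure_pmf.finite_measure_mono)
        show "{u. \<forall>v<n. star_label E (centres n j t) (u v) v \<in> S \<longleftrightarrow> v \<in> S} \<subseteq> {u. (t, u) \<in> ?X}"
        proof (rule subsetI, rule CollectI, rule CollectI, rule succ, rule conjI)
          fix u assume u: "u \<in> {u. \<forall>v<n. star_label E (centres n j t) (u v) v \<in> S \<longleftrightarrow> v \<in> S}"
          then have side: "l t u v \<in> S \<longleftrightarrow> v \<in> S" if "v < n" for v using that by (simp add: l_def)
          then show "sat n (l t u) S" unfolding sat_def by metis
          \<comment> \<open>Every vertex sees a centre, so only centres survive as labels and the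
            bound on their number carries over.\<close>
          have "l t u ` {..<n} \<subseteq> centres n j t"
          proof
            fix y assume "y \<in> l t u ` {..<n}"
            then obtain v where v: "v < n" "y = l t u v" by auto
            have "card ((nbrs E v - cross_nbrs E S v) \<inter> centres n j t) > 0"
              using good v by (fastforce simp: good_centres_def)
            then have ne: "nbrs E v \<inter> centres n j t \<noteq> {}" by (auto simp: card_gt_0_iff)
            show "y \<in> centres n j t"
            proof (cases "v \<in> centres n j t")
              case True
              then show ?thesis using v by (simp add: l_def star_label_def)
            next
              case False
              then show ?thesis using star_label_spec(1)[OF False finR ne] v by (simp add: l_def)
            qed
          qed
          from card_mono[OF finR this] show "card (l t u ` {..<n}) \<le> 8 * j"
            using good by (auto simp: good_centres_def)
        qed
      qed simp
      finally show "exp (- 256) \<le> measure_pmf.prob (choice_pmf n) {u. (t, u) \<in> ?X}" .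
    qed simp
    then show ?thesis by simp
  qed
qed

section \<open>From one run to high probability\<close>

lemma solves_imp_qtree:
  assumes "solves G q P"
  obtains t where "\<And>E. E \<in> G \<Longrightarrow> P E (run (cut_val E) t)"
    "\<And>E. E \<in> G \<Longrightarrow> num_queries (cut_val E) t \<le> q"
proof -
  obtain t where t: "\<forall>E\<in>G. \<exists>x. P E x \<and> run (cut_val E) t = run (cut_val E) (Output x) \<and>
     num_queries (cut_val E) t \<le> q + num_queries (cut_val E) (Output x)"
    using assms unfolding solves_def by blast
  then show thesis by (intro that[of t]) force+
qed

lemma prob_some_success:
  assumes "0 \<le> \<delta>" "\<delta> \<le> 1" "\<delta> \<le> measure_pmf.prob M {w. P w}"
  shows "1 - exp (- (\<delta> * real K)) \<le>
    measure_pmf.prob (Pi_pmf {..<K} w0 (\<lambda>_. M)) {ws. \<exists>i<K. P (ws i)}"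
proof -
  let ?N = "Pi_pmf {..<K} w0 (\<lambda>_. M)"
  have c: "measure_pmf.prob M {w. \<not> P w} = 1 - measure_pmf.prob M {w. P w}"
    using measure_pmf.prob_compl[of "{w. P w}" M]
    by (auto simp: Compl_eq_Diff_UNIV[symmetric] Collect_neg_eq[symmetric])
  have "{ws. \<not> (\<exists>i<K. P (ws i))} = Pi {..<K} (\<lambda>_. {w. \<not> P w})" by auto
  then have "measure_pmf.prob ?N {ws. \<not> (\<exists>i<K. P (ws i))} = (1 - measure_pmf.prob M {w. P w}) ^ K"
    using measure_Pi_pmf_Pi[of "{..<K}" w0 "\<lambda>_. M" "\<lambda>_. {w. \<not> P w}"] by (simp add: c)
  also have "\<dots> \<le> (1 - \<delta>) ^ K" using assms by (intro power_mono) auto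
  also have "\<dots> \<le> exp (- \<delta>) ^ K"
    using assms exp_ge_add_one_self[of "- \<delta>"] by (intro power_mono) auto
  also have "\<dots> = exp (- (\<delta> * real K))" by (simp add: exp_of_nat_mult[symmetric] mult.commute)
  finally have "measure_pmf.prob ?N {ws. \<not> (\<exists>i<K. P (ws i))} \<le> exp (- (\<delta> * real K))" .
  moreover have "measure_pmf.prob ?N {ws. \<exists>i<K. P (ws i)} = 1 - measure_pmf.prob ?N {ws. \<not> (\<exists>i<K. P (ws i))}"
    using measure_pmf.prob_compl[of "{ws. \<not> (\<exists>i<K. P (ws i))}" ?N]
    by (auto simp: Compl_eq_Diff_UNIV[symmetric] Collect_neg_eq[symmetric])
  ultimately show ?thesis by linarith
qed

lemma log2_bounds:
  assumes "8 \<le> n"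
  defines "L \<equiv> nat \<lceil>log 2 (real n)\<rceil>"
  shows "n \<le> 2 ^ L" "1 \<le> L" "ln n \<le> L" "real L \<le> 4 * ln n"
proof -
  have lg: "3 \<le> log 2 (real n)"
    using assms by (subst le_log_iff) auto
  have L: "log 2 (real n) \<le> L" "L \<le> log 2 (real n) + 1" using lg unfolding L_def by linarith+
  have "real n = 2 powr (log 2 (real n))" using assms by simp
  also have "\<dots> \<le> 2 powr L" using L by (intro powr_mono) auto
  also have "\<dots> = real (2 ^ L)" by (simp add: powr_realpow)
  finally show "n \<le> 2 ^ L" by (simp only: of_nat_le_iff)
  show "1 \<le> L" using L lg by linarith
  have ln2: "1 / 2 \<le> ln (2 :: real)" "ln (2 :: real) \<le> 1"
    using ln_le_minus_one[of "1 / 2 :: real"] ln_le_minus_one[of "2 :: real"] by (simp_all add: ln_div)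
  have lnn: "ln n = log 2 (real n) * ln 2" by (simp add: log_def)
  have "log 2 (real n) * ln 2 \<le> log 2 (real n) * 1" using ln2 lg by (intro mult_left_mono) auto
  then show "ln n \<le> L" using L lnn by linarith
  have "log 2 (real n) * (1 / 2) \<le> log 2 (real n) * ln 2" using ln2 lg by (intro mult_left_mono) auto
  \<comment> \<open>\<open>L\<close> \<le> log2 n + 1 \<le> 2 log2 n, and log2 n \<le> 2 ln n
    because ln 2 \<ge> 1/2.\<close>
  then show "real L \<le> 4 * ln n" using L lnn lg by linarith
qed

theorem mainTheorem1:
  shows "\<exists>A :: nat \<Rightarrow> qtree pmf. \<exists>C k N. \<exists>c>0.
    \<forall>n\<ge>N. \<forall>E. simple_graph n E \<longrightarrow>
      (\<forall>t\<in>set_pmf (A n). real (num_queries (cut_val E) t) \<le> C * real n * (ln (real n)) ^ k) \<and>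
      measure_pmf.prob (A n) {t. is_global_min_cut n E (run (cut_val E) t)}
        \<ge> 1 - real n powr (- c)"
proof -
  define \<delta> :: real where "\<delta> = exp (- 256) / 2"
  have "exp (- 256) \<le> (1 :: real)" by simp
  then have \<delta>: "0 < \<delta>" "\<delta> \<le> 1" by (simp add: \<delta>_def, unfold \<delta>_def, linarith)
  \<comment> \<open>With \<open>M * L n\<close> runs the failure probability is at most exp (-
    \<open>L n\<close>) \<le> 1/n.\<close>
  define M where "M = nat \<lceil>1 / \<delta>\<rceil>"
  have "1 / \<delta> \<le> real M" unfolding M_def by linarith
  then have M: "1 \<le> \<delta> * M" using \<delta> by (simp add: field_simps)
  define L where "L n = nat \<lceil>log 2 (real n)\<rceil>" for n
  define K where "K n = M * L n" for n
  define good where "good n ws t \<longleftrightarrow> (\<forall>E\<in>graphs n.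
      ((\<exists>i<K n. star_contraction_succeeds n (L n) E (ws i)) \<longrightarrow> is_global_min_cut n E (run (cut_val E) t)) \<and>
      num_queries (cut_val E) t \<le> (1520 * n * (L n)\<^sup>2 + 2) * K n)" for n ws t
  \<comment> \<open>For each seed vector one tree serves all graphs simultaneously, so the
    distribution of trees does not depend on \<open>E\<close>.\<close>
  define tree where "tree n ws = (SOME t. good n ws t)" for n ws
  have tree: "good n ws (tree n ws)" if n: "8 \<le> n" for n ws
  proof -
    note L = log2_bounds[OF n, folded L_def]
    let ?ws = "map ws [0..<K n]"
    have "solves (graphs n) ((1520 * n * (L n)\<^sup>2 + 2) * length ?ws)
      (\<lambda>E T. T \<noteq> {} \<and> T \<subset> {..<n} \<and>
        ((\<exists>w\<in>set ?ws. star_contraction_succeeds n (L n) E w) \<longrightarrow> is_global_min_cut n E T))"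
      by (rule solves_best_of, use n in simp, rule solves_star_contraction) (use n L in auto)
    from solves_imp_qtree[OF this] obtain t where
      t: "\<And>E. E \<in> graphs n \<Longrightarrow> (\<exists>w\<in>set ?ws. star_contraction_succeeds n (L n) E w) \<longrightarrow>
            is_global_min_cut n E (run (cut_val E) t)"
         "\<And>E. E \<in> graphs n \<Longrightarrow> num_queries (cut_val E) t \<le> (1520 * n * (L n)\<^sup>2 + 2) * length ?ws"
      by metis
    have "good n ws t" unfolding good_def using t by fastforce
    then show ?thesis unfolding tree_def by (rule someI)
  qed
  define seeds where "seeds n = Pi_pmf {..<K n} undefined (\<lambda>_. star_pmf n)" for n
  define A where "A n = map_pmf (tree n) (seeds n)" for n
  \<comment> \<open>1522 = 1520 + 2 absorbs the two comparison queries, and 64 = 4^3 comes from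
    \<open>L n\<close> \<le> 4 ln n.\<close>
  define C where "C = 1522 * real M * 64"
  have "real (num_queries (cut_val E) t) \<le> C * real n * (ln (real n)) ^ 3"
    if n: "8 \<le> n" and E: "simple_graph n E" and t: "t \<in> set_pmf (A n)" for n E t
  proof -
    note L = log2_bounds[OF n, folded L_def]
    obtain ws where ws: "t = tree n ws" using t by (auto simp: A_def)
    have "num_queries (cut_val E) t \<le> (1520 * n * (L n)\<^sup>2 + 2) * K n"
      using tree[OF n, of ws] E unfolding good_def ws graphs_def by blast
    also have "\<dots> \<le> (1522 * n * (L n)\<^sup>2) * K n"
    proof (rule mult_le_mono1)
      have "1 * 1 \<le> n * (L n)\<^sup>2" using L(2) n by (intro mult_le_mono) auto
      then show "1520 * n * (L n)\<^sup>2 + 2 \<le> 1522 * n * (L n)\<^sup>2" by simp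
    qed
    also have "\<dots> = 1522 * M * n * (L n) ^ 3" by (simp add: K_def power2_eq_square power3_eq_cube)
    finally have "real (num_queries (cut_val E) t) \<le> real (1522 * M * n * (L n) ^ 3)"
      by (simp only: of_nat_le_iff)
    also have "\<dots> = 1522 * real M * real n * real (L n) ^ 3" by simp
    also have "\<dots> \<le> 1522 * real M * real n * (4 * ln (real n)) ^ 3"
      using L(4) by (intro mult_left_mono power_mono) auto
    also have "\<dots> = C * real n * (ln (real n)) ^ 3" by (simp add: C_def power_mult_distrib)
    finally show ?thesis .
  qed
  moreover have "1 - real n powr (- 1) \<le>
      measure_pmf.prob (A n) {t. is_global_min_cut n E (run (cut_val E) t)}"
    if n: "8 \<le> n" and E: "simple_graph n E" for n E
  proof -
    note L = log2_bounds[OF n, folded L_def]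
    have Eg: "E \<in> graphs n" using E by (simp add: graphs_def)
    have "ln n * 1 \<le> L n * (\<delta> * M)" using L(3) M n by (intro mult_mono) auto
    then have "exp (- (\<delta> * real (K n))) \<le> exp (- ln n)" by (simp add: K_def mult_ac)
    also have "\<dots> = real n powr (- 1)" using n by (simp add: powr_def)
    finally have "1 - real n powr (- 1) \<le> 1 - exp (- (\<delta> * real (K n)))" by linarith
    also have "\<dots> \<le> measure_pmf.prob (seeds n)
        {ws. \<exists>i<K n. star_contraction_succeeds n (L n) E (ws i)}"
      unfolding seeds_def
      by (rule prob_some_success)
        (use \<delta> prob_star_contraction_succeeds[OF Eg n L(3)] in \<open>auto simp: \<delta>_def\<close>)
    also have "\<dots> \<le> measure_pmf.prob (seeds n) {ws. is_global_min_cut n E (run (cut_val E) (tree n ws))}"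
      using tree[OF n] Eg by (intro measure_pmf.finite_measure_mono) (auto simp: good_def)
    also have "\<dots> = measure_pmf.prob (A n) {t. is_global_min_cut n E (run (cut_val E) t)}"
      unfolding A_def by (simp add: vimage_def)
    finally show ?thesis .
  qed
  ultimately have "\<forall>n\<ge>8. \<forall>E. simple_graph n E \<longrightarrow>
      (\<forall>t\<in>set_pmf (A n). real (num_queries (cut_val E) t) \<le> C * real n * (ln (real n)) ^ 3) \<and>
      measure_pmf.prob (A n) {t. is_global_min_cut n E (run (cut_val E) t)} \<ge> 1 - real n powr (- 1)"
    by blast
  \<comment> \<open>The three logarithms stem from the density of centres, the bisections and the
    repetitions; from n = 8 on, the sampling failures \<open>2 / n\<close> are at most 1/4.\<close>
  then show ?thesis
    by (intro exI[of _ A] exI[of _ C] exI[of _ "3::nat"] exI[of _ "8::nat"] exI[of _ "1::real"]) simp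
qed

end
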